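(* Let $d \geq 2$ and let $\{B_n\}$ be any sequence of finite sets of edges of $\mathbf{Z}^d$, each forming a connected graph, converging to $\mathbf{Z}^d$ in the sense that every edge of $\mathbf{Z}^d$ belongs to all but finitely many of the sets $B_n$. Then the measures $\mu_1(B_n)$ converge weakly to a limiting measure $\mu$, in the sense that $\mu_1(B_n)(C) \rightarrow \mu(C)$ for every cylinder event $C$. The measure $\mu$ is concentrated on spanning forests of $\mathbf{Z}^d$ and is translation invariant.
   Context: $\mathbf{Z}^d$ denotes the nearest neighbor graph on the $d$-dimensional integer lattice, with an edge between $(v_1,\ldots,v_d)$ and $(w_1,\ldots,w_d)$ iff $\sum_i |v_i-w_i|=1$. A subgraph of $\mathbf{Z}^d$ is any subcollection of these edges, viewed as a map from the set of edges to $\{0,1\}$; the space of subgraphs has the product topology and its Borel $\sigma$-field, and cylinder events are those depending on only finitely many edges. A finite set of edges is regarded as a finite graph whose vertices are the endpoints of its edges. A subgraph of $\mathbf{Z}^d$ spans $\mathbf{Z}^d$ if it contains at least one edge incident to each vertex of $\mathbf{Z}^d$; a forest is a graph with no loops (cycles); a spanning forest is a forest that spans. For a finite connected graph $G$, $\mu_1(G)$ is the uniform probability measure on spanning trees of $G$; when $G$ is a finite subgraph of $\mathbf{Z}^d$, $\mu_1(G)$ is viewed as a measure on subgraphs of $\mathbf{Z}^d$ (a spanning tree of $G$ being a set of edges of $\mathbf{Z}^d$). *)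

theory Defs
  imports "HOL-Probability.Probability"
begin

section \<open>The nearest neighbor graph on the integer lattice\<close>

definition nearest_neighbors :: "int ^ 'd \<Rightarrow> int ^ 'd \<Rightarrow> bool" where
  "nearest_neighbors v w \<longleftrightarrow> (\<Sum>i\<in>UNIV. \<bar>v $ i - w $ i\<bar>) = 1"

lemma nearest_neighbors_translate: "nearest_neighbors (a + v) (a + w) \<longleftrightarrow> nearest_neighbors v w"
  by (simp add: nearest_neighbors_def)

lemma nearest_neighbors_axis: "nearest_neighbors 0 (axis k 1 :: int ^ 'd)"
proof -
  have "(\<Sum>i\<in>UNIV. \<bar>(0 :: int ^ 'd) $ i - (axis k 1 :: int ^ 'd) $ i\<bar>) = (\<Sum>i\<in>UNIV. if i = k then 1 else 0)"
    by (intro sum.cong) (auto simp: axis_def)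
  then show ?thesis by (simp add: nearest_neighbors_def)
qed

text \<open>Edges are undirected: an edge is the set of its two endpoints.\<close>

typedef ('d :: finite) edge = "{{v, w} | v w :: int ^ 'd. nearest_neighbors v w}"
  morphisms ends Edge
  using nearest_neighbors_axis by blast

setup_lifting type_definition_edge

lift_definition translate_edge :: "int ^ 'd \<Rightarrow> 'd::finite edge \<Rightarrow> 'd edge"
  is "\<lambda>a e. (+) a ` e"
proof -
  fix a :: "int ^ 'd" and e :: "(int ^ 'd) set"
  assume "\<exists>v w. e = {v, w} \<and> nearest_neighbors v w"
  then obtain v w where "e = {v, w}" "nearest_neighbors v w" by blast
  then have "(+) a ` e = {a + v, a + w} \<and> nearest_neighbors (a + v) (a + w)"
    by (simp add: nearest_neighbors_translate)
  then show "\<exists>v w. (+) a ` e = {v, w} \<and> nearest_neighbors v w" by blast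
qed


section \<open>Graphs given by sets of edges\<close>

text \<open>A set of edges is regarded as a graph whose vertices are the endpoints of its edges. The
  forests and trees of \<open>Graph_Theory\<close> are defined by directed cycles (so that an undirected edge,
  encoded as two opposite arcs, would already be a cycle) and are therefore not used here.\<close>

definition vertices :: "'d::finite edge set \<Rightarrow> (int ^ 'd) set" where
  "vertices F = (\<Union>e\<in>F. ends e)"

definition adjacent :: "'d::finite edge set \<Rightarrow> int ^ 'd \<Rightarrow> int ^ 'd \<Rightarrow> bool" where
  "adjacent F v w \<longleftrightarrow> (\<exists>e\<in>F. ends e = {v, w})"

definition connected_graph :: "'d::finite edge set \<Rightarrow> bool" where
  "connected_graph F \<longleftrightarrow> (\<forall>v\<in>vertices F. \<forall>w\<in>vertices F. (adjacent F)\<^sup>*\<^sup>* v w)"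

text \<open>The vertices of a cycle are listed once each; the closing step leads from the last vertex
  back to the first. As there are no multiple edges, a cycle has at least three vertices.\<close>

definition cycle :: "'d::finite edge set \<Rightarrow> (int ^ 'd) list \<Rightarrow> bool" where
  "cycle F vs \<longleftrightarrow> 3 \<le> length vs \<and> distinct vs \<and>
     (\<forall>i. Suc i < length vs \<longrightarrow> adjacent F (vs ! i) (vs ! Suc i)) \<and> adjacent F (last vs) (hd vs)"

definition forest :: "'d::finite edge set \<Rightarrow> bool" where
  "forest F \<longleftrightarrow> (\<nexists>vs. cycle F vs)"

definition tree :: "'d::finite edge set \<Rightarrow> bool" where
  "tree F \<longleftrightarrow> connected_graph F \<and> forest F"

definition spanning_trees :: "'d::finite edge set \<Rightarrow> 'd edge set set" where
  "spanning_trees G = {T. T \<subseteq> G \<and> vertices T = vertices G \<and> tree T}"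


section \<open>Random subgraphs of the lattice\<close>

text \<open>A subgraph is a map from the edges to \<open>bool\<close> (in place of 0 and 1). The topology of this
  function type is the product topology; the library's order topology on \<open>bool\<close> is the discrete
  one.\<close>

type_synonym 'd lattice_subgraph = "'d edge \<Rightarrow> bool"

lemma open_bool: "open (S :: bool set)"
proof -
  have *: "open {b}" for b :: bool
  proof (cases b)
    case True
    then have "{b} = {False<..}" by auto
    then show ?thesis by (metis open_greaterThan)
  next
    case False
    then have "{b} = {..<True}" by auto
    then show ?thesis by (metis open_lessThan)
  qed
  have "open (\<Union>b\<in>S. {b})" by (intro open_UN ballI *)
  then show ?thesis by simp
qed

definition cylinder_event :: "'d::finite lattice_subgraph set \<Rightarrow> bool" where
  "cylinder_event C \<longleftrightarrow>
     (\<exists>F. finite F \<and> (\<forall>\<omega> \<omega>'. (\<forall>e\<in>F. \<omega> e = \<omega>' e) \<longrightarrow> (\<omega> \<in> C \<longleftrightarrow> \<omega>' \<in> C)))"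

definition spans_lattice :: "'d::finite lattice_subgraph \<Rightarrow> bool" where
  "spans_lattice \<omega> \<longleftrightarrow> (\<forall>v. \<exists>e. \<omega> e \<and> v \<in> ends e)"

definition spanning_forest :: "'d::finite lattice_subgraph \<Rightarrow> bool" where
  "spanning_forest \<omega> \<longleftrightarrow> forest {e. \<omega> e} \<and> spans_lattice \<omega>"

definition translate_subgraph ::
    "int ^ 'd \<Rightarrow> 'd::finite lattice_subgraph \<Rightarrow> 'd lattice_subgraph" where
  "translate_subgraph a \<omega> = (\<lambda>e. \<omega> (translate_edge (- a) e))"

lemma measurable_translate_subgraph:
  "translate_subgraph a \<in> borel_measurable (borel :: 'd::finite lattice_subgraph measure)"
proof (rule borel_measurable_continuous_onI)
  show "continuous_on UNIV (translate_subgraph a :: 'd lattice_subgraph \<Rightarrow> _)"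
    unfolding translate_subgraph_def
    by (intro continuous_on_coordinatewise_then_product continuous_on_product_coordinates)
qed

definition translation_invariant :: "'d::finite lattice_subgraph measure \<Rightarrow> bool" where
  "translation_invariant M \<longleftrightarrow> (\<forall>a. distr M borel (translate_subgraph a) = M)"

text \<open>The uniform measure on the spanning trees of a finite connected graph, transported to the
  space of subgraphs of the lattice by identifying a tree with the indicator of its edge set.\<close>

definition uniform_spanning_tree :: "'d::finite edge set \<Rightarrow> 'd lattice_subgraph measure" where
  "uniform_spanning_tree G = distr (uniform_count_measure (spanning_trees G)) borel (\<lambda>T e. e \<in> T)"

end

theory Submission
  imports Defs "HOL-Library.Transitive_Closure_Table"
begin

text \<open>The heart of the matter is Rayleigh's monotonicity principle: for a fixed edge, the
  probability of lying in the random spanning tree can only decrease when the graph grows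
  (\<open>rayleigh_monotonicity\<close>). Kirchhoff's reason is electrical. Let \<open>e\<close> join \<open>x\<close> and \<open>y\<close>. Each spanning
  tree carries exactly one unit flow from \<open>x\<close> to \<open>y\<close>, and the sum of these flows over all trees is the
  gradient of a potential (\<open>kirchhoff_current\<close>). Divided by the number of trees it is therefore the
  unit flow of least energy, and its energy is the potential drop, which is the probability of
  \<open>e\<close>. A unit flow in a graph is also one in every larger graph, so the least energy decreases.

  Conditioning on the absence of edges amounts to deleting them. Multiplying conditional probabilities
  edge by edge, one finds that the probability that the tree avoids a finite set \<open>F\<close> of edges
  increases with the graph, as soon as the graph contains \<open>F\<close> (\<open>forest_prob_avoid_mono\<close>). A bounded
  monotone function has a limit along the net of all finite edge sets, and by inclusion and exclusion so
  does the probability of every cylinder event (\<open>forest_prob_converges\<close>). Since the limit is taken along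
  the whole net, it is the limit along every exhausting sequence at once; translating
  the net yields translation invariance without comparing two sequences.

  The limits form a finitely additive function on the algebra of cylinder events. These are clopen in a
  compact space, so Caratheodory's theorem extends it to a measure (\<open>lattice_measure_exists\<close>). A given
  cycle, or a given isolated vertex, is a cylinder event that is impossible in every large finite
  graph, hence null in the limit; there are countably many of them.\<close>

section \<open>Spanning forests of finite graphs\<close>

abbreviation joined :: "'d::finite edge set \<Rightarrow> int ^ 'd \<Rightarrow> int ^ 'd \<Rightarrow> bool" where
  "joined F \<equiv> (adjacent F)\<^sup>*\<^sup>*"

lemma ends_distinct: "ends e = {u, v} \<Longrightarrow> u \<noteq> v"
proof
  assume e: "ends e = {u, v}" "u = v"
  from ends[of e] obtain a b where "ends e = {a, b}" "nearest_neighbors a b" by auto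
  with e show False
    by (auto simp: doubleton_eq_iff nearest_neighbors_def)
qed

lemma ends_cases:
  obtains u v where "ends e = {u, v}" "u \<noteq> v"
proof -
  from ends[of e] obtain a b where "ends e = {a, b}" by auto
  with that ends_distinct show ?thesis by metis
qed

lemma adjacent_sym: "adjacent F u v \<Longrightarrow> adjacent F v u"
  unfolding adjacent_def by (simp add: insert_commute)

lemma adjacent_distinct: "adjacent F u v \<Longrightarrow> u \<noteq> v"
  unfolding adjacent_def using ends_distinct by blast

lemma adjacent_mono: "F \<subseteq> G \<Longrightarrow> adjacent F u v \<Longrightarrow> adjacent G u v"
  unfolding adjacent_def by blast

lemma adjacent_vertices: "adjacent F u v \<Longrightarrow> u \<in> vertices F \<and> v \<in> vertices F"
  unfolding adjacent_def vertices_def by blast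

lemma finite_vertices:
  fixes F :: "'d::finite edge set"
  assumes "finite F"
  shows "finite (vertices F)"
  unfolding vertices_def
proof (intro finite_UN_I assms)
  show "finite (ends e)" for e :: "'d edge" by (rule ends_cases[of e]) simp
qed

lemma vertices_mono: "F \<subseteq> G \<Longrightarrow> vertices F \<subseteq> vertices G"
  unfolding vertices_def by blast

lemma joined_sym: "joined F u v \<Longrightarrow> joined F v u"
  by (induction rule: rtranclp_induct)
    (auto intro: adjacent_sym converse_rtranclp_into_rtranclp)

lemma joined_mono: "F \<subseteq> G \<Longrightarrow> joined F u v \<Longrightarrow> joined G u v"
  by (metis adjacent_mono mono_rtranclp)

lemma joined_edge: "e \<in> F \<Longrightarrow> ends e = {u, v} \<Longrightarrow> joined F u v"
  unfolding adjacent_def by blast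

lemma joined_vertices:
  assumes "joined F u v" "u \<noteq> v"
  shows "u \<in> vertices F \<and> v \<in> vertices F"
  using assms by (metis adjacent_vertices converse_rtranclpE rtranclp.cases)

lemma joined_insert:
  assumes "ends e = {a, b}"
  shows "joined (insert e F) u v \<longleftrightarrow>
    joined F u v \<or> joined F u a \<and> joined F b v \<or> joined F u b \<and> joined F a v"
    (is "_ \<longleftrightarrow> ?R v")
proof
  assume "joined (insert e F) u v"
  then show "?R v"
  proof (induction rule: rtranclp_induct)
    case base
    then show ?case by simp
  next
    case (step y z)
    from step.hyps(2) consider "adjacent F y z" | "{y, z} = {a, b}"
      unfolding adjacent_def using assms by auto
    then show ?case
    proof cases
      case 1
      with step.IH show ?thesis by (meson rtranclp.rtrancl_into_rtrancl)
    next
      case 2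
      then have "y = a \<and> z = b \<or> y = b \<and> z = a" by (auto simp: doubleton_eq_iff)
      with step.IH show ?thesis by auto
    qed
  qed
next
  have ab: "joined (insert e F) a b" by (rule joined_edge[OF _ assms]) simp
  have m: "joined (insert e F) p q" if "joined F p q" for p q
    by (rule joined_mono[OF _ that]) blast
  assume "?R v"
  then show "joined (insert e F) u v"
    by (metis ab m joined_sym rtranclp_trans)
qed

text \<open>Acyclicity in the form in which it is used below: every edge is a bridge. Unlike a list of
  vertices, this behaves well under deleting and inserting edges.\<close>

definition acyclic_edges :: "'d::finite edge set \<Rightarrow> bool" where
  "acyclic_edges F \<longleftrightarrow> (\<forall>e\<in>F. \<forall>u v. ends e = {u, v} \<longrightarrow> \<not> joined (F - {e}) u v)"

text \<open>A detour between the endpoints of an edge can be shortened to a path without repetitions;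
  closing it up with the edge gives a cycle, which has three vertices because no other edge has the same
  endpoints. Conversely, a cycle without its closing edge is a detour.\<close>

lemma forest_iff_acyclic_edges: "forest F \<longleftrightarrow> acyclic_edges F"
proof
  assume F: "forest F"
  show "acyclic_edges F"
    unfolding acyclic_edges_def
  proof (intro ballI allI impI notI)
    fix e u v
    assume e: "e \<in> F" "ends e = {u, v}" and j: "joined (F - {e}) u v"
    from j obtain xs where "rtrancl_path (adjacent (F - {e})) u xs v"
      unfolding rtranclp_eq_rtrancl_path by blast
    then obtain xs where p: "rtrancl_path (adjacent (F - {e})) u xs v" and d: "distinct (u # xs)"
      by (rule rtrancl_path_distinct)
    have uv: "u \<noteq> v" using e ends_distinct by blast
    have step: "adjacent (F - {e}) ((u # xs) ! i) ((u # xs) ! Suc i)" if "i < length xs" for i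
      using rtrancl_path_nth[OF p that] by simp
    have ne: "xs \<noteq> []" using p uv by (auto elim: rtrancl_path.cases)
    then have last: "last xs = v" using rtrancl_path_last[OF p] by simp
    have "length xs \<noteq> 1"
    proof
      assume "length xs = 1"
      then have "xs = [v]" using last by (cases xs) auto
      with step[of 0] have "adjacent (F - {e}) u v" by simp
      then obtain e' where "e' \<in> F - {e}" "ends e' = {u, v}" unfolding adjacent_def by blast
      with e show False by (metis DiffD2 ends_inject singletonI)
    qed
    with ne have len: "3 \<le> length (u # xs)" by (cases xs) (auto simp: Suc_le_eq)
    have "cycle F (u # xs)"
      unfolding cycle_def
    proof (intro conjI allI impI)
      show "3 \<le> length (u # xs)" by (rule len)
      show "distinct (u # xs)" by (rule d)
      show "adjacent F ((u # xs) ! i) ((u # xs) ! Suc i)" if "Suc i < length (u # xs)" for i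
        using step[of i] that by (auto intro: adjacent_mono[of "F - {e}"])
      show "adjacent F (last (u # xs)) (hd (u # xs))"
        using e ne last by (auto simp: adjacent_def insert_commute)
    qed
    with F show False unfolding forest_def by blast
  qed
next
  assume A: "acyclic_edges F"
  show "forest F"
    unfolding forest_def
  proof
    assume "\<exists>vs. cycle F vs"
    then obtain vs where c: "cycle F vs" ..
    then have len: "3 \<le> length vs" and d: "distinct vs"
      and st: "\<And>i. Suc i < length vs \<Longrightarrow> adjacent F (vs ! i) (vs ! Suc i)"
      and cl: "adjacent F (last vs) (hd vs)" unfolding cycle_def by auto
    from cl obtain e where e: "e \<in> F" "ends e = {hd vs, last vs}"
      unfolding adjacent_def by (auto simp: insert_commute)
    have hd: "hd vs = vs ! 0" and la: "last vs = vs ! (length vs - 1)"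
      using len by (metis hd_conv_nth last_conv_nth list.size(3) not_numeral_le_zero)+
    have "joined (F - {e}) (vs ! 0) (vs ! i)" if "i < length vs" for i
      using that
    proof (induction i)
      case (Suc i)
      from st[OF Suc.prems] obtain e' where e': "e' \<in> F" "ends e' = {vs ! i, vs ! Suc i}"
        unfolding adjacent_def by blast
      have "e' \<noteq> e"
      proof
        assume "e' = e"
        then have "{vs ! i, vs ! Suc i} = {vs ! 0, vs ! (length vs - 1)}"
          using e' e hd la by simp
        then have "i = 0 \<and> Suc i = length vs - 1 \<or> i = length vs - 1 \<and> Suc i = 0"
        proof -
          have "0 < length vs" "length vs - 1 < length vs" "i < length vs"
            using Suc.prems len by linarith+
          with \<open>{_, _} = _\<close> Suc.prems show ?thesis
            by (simp add: doubleton_eq_iff nth_eq_iff_index_eq[OF d])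
        qed
        then show False using len by auto
      qed
      with e' have "adjacent (F - {e}) (vs ! i) (vs ! Suc i)" unfolding adjacent_def by blast
      with Suc show ?case by (meson Suc_lessD rtranclp.rtrancl_into_rtrancl)
    qed simp
    from this[of "length vs - 1"] have "joined (F - {e}) (hd vs) (last vs)"
      using len hd la by (metis diff_less less_le_trans zero_less_numeral zero_less_one)
    with A e show False unfolding acyclic_edges_def by blast
  qed
qed

lemma acyclic_edges_mono: "acyclic_edges G \<Longrightarrow> F \<subseteq> G \<Longrightarrow> acyclic_edges F"
  unfolding acyclic_edges_def
  by (metis (no_types, opaque_lifting) Diff_mono joined_mono order_refl subsetD)

text \<open>If the new edge created a detour around an old edge \<open>g\<close>, the detour would pass through
  the new edge, and \<open>g\<close> together with the two remaining pieces would already join its endpoints.\<close>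

lemma acyclic_edges_insert:
  assumes F: "acyclic_edges F" and e: "ends e = {x, y}" and xy: "\<not> joined F x y"
  shows "acyclic_edges (insert e F)"
  unfolding acyclic_edges_def
proof (intro ballI allI impI notI)
  fix g p q
  assume g: "g \<in> insert e F" "ends g = {p, q}" and j: "joined (insert e F - {g}) p q"
  show False
  proof (cases "g = e")
    case True
    have "joined F p q" by (rule joined_mono[OF _ j]) (use True in auto)
    moreover have "{p, q} = {x, y}" using g e True by simp
    ultimately show False using xy joined_sym by (metis doubleton_eq_iff)
  next
    case False
    with g have gF: "g \<in> F" by simp
    have "insert e F - {g} = insert e (F - {g})" using False by blast
    with j have "joined (F - {g}) p q \<or> joined (F - {g}) p x \<and> joined (F - {g}) y q
        \<or> joined (F - {g}) p y \<and> joined (F - {g}) x q"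
      using joined_insert[OF e, of "F - {g}"] by simp
    moreover have "\<not> joined (F - {g}) p q" using F gF g unfolding acyclic_edges_def by blast
    ultimately have "joined F p x \<and> joined F y q \<or> joined F p y \<and> joined F x q"
      using joined_mono[of "F - {g}" F] by blast
    moreover have "joined F p q" using joined_edge gF g by blast
    ultimately show False using xy by (metis joined_sym rtranclp_trans)
  qed
qed

text \<open>The maximal forests of \<open>G\<close>: one spanning tree in each component. Disconnected graphs are
  admitted because edges will be deleted.\<close>

definition spanning_forests :: "'d::finite edge set \<Rightarrow> 'd edge set set" where
  "spanning_forests G = {T. T \<subseteq> G \<and> acyclic_edges T \<and> joined T = joined G}"

lemma finite_spanning_forests: "finite G \<Longrightarrow> finite (spanning_forests G)"
  unfolding spanning_forests_def by (rule finite_subset[of _ "Pow G"]) auto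

text \<open>An edge set of least size that joins the same pairs of vertices as \<open>G\<close> has no superfluous
  edge.\<close>

lemma spanning_forests_nonempty:
  assumes "finite G"
  shows "spanning_forests G \<noteq> {}"
proof -
  let ?P = "\<lambda>T. T \<subseteq> G \<and> joined T = joined G"
  define T where "T = arg_min card ?P"
  have T: "?P T" unfolding T_def by (rule arg_min_natI[of ?P G]) simp
  have min: "card T \<le> card S" if "?P S" for S
    unfolding T_def using that by (rule arg_min_nat_le)
  have fin: "finite T" using T assms finite_subset by blast
  have "acyclic_edges T"
    unfolding acyclic_edges_def
  proof (intro ballI allI impI notI)
    fix e u v
    assume e: "e \<in> T" "ends e = {u, v}" and j: "joined (T - {e}) u v"
    have "joined T = joined (T - {e})"
    proof (intro ext iffI)
      fix p q
      assume "joined T p q"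
      then have "joined (insert e (T - {e})) p q" using e by (simp add: insert_absorb)
      then show "joined (T - {e}) p q"
        unfolding joined_insert[OF e(2)] using j by (metis joined_sym rtranclp_trans)
    next
      fix p q
      show "joined (T - {e}) p q \<Longrightarrow> joined T p q" by (rule joined_mono) auto
    qed
    then have "card T \<le> card (T - {e})" using T by (intro min) auto
    then show False using fin e by (metis card_Diff1_less not_le)
  qed
  with T show ?thesis unfolding spanning_forests_def by blast
qed

lemma card_spanning_forests_pos: "finite G \<Longrightarrow> 0 < card (spanning_forests G)"
  by (simp add: card_gt_0_iff finite_spanning_forests spanning_forests_nonempty)

lemma vertices_spanning_forest:
  assumes "T \<in> spanning_forests G"
  shows "vertices T = vertices G"
proof
  show "vertices T \<subseteq> vertices G"
    using assms by (intro vertices_mono) (auto simp: spanning_forests_def)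
  show "vertices G \<subseteq> vertices T"
  proof
    fix v
    assume "v \<in> vertices G"
    then obtain e where e: "e \<in> G" "v \<in> ends e" unfolding vertices_def by blast
    then obtain w where w: "ends e = {v, w}" "v \<noteq> w"
      by (rule_tac ends_cases[of e]) (auto simp: insert_commute)
    then have "joined T v w"
      using joined_edge[OF e(1)] assms by (simp add: spanning_forests_def)
    with w show "v \<in> vertices T" using joined_vertices by blast
  qed
qed

lemma spanning_trees_eq_spanning_forests:
  assumes "connected_graph G"
  shows "spanning_trees G = spanning_forests G"
proof (intro set_eqI iffI)
  fix T
  assume "T \<in> spanning_trees G"
  then have T: "T \<subseteq> G" "vertices T = vertices G" "connected_graph T" "acyclic_edges T"
    by (auto simp: spanning_trees_def tree_def forest_iff_acyclic_edges)
  have "joined T = joined G"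
  proof (intro ext iffI)
    fix u v
    show "joined T u v \<Longrightarrow> joined G u v" by (rule joined_mono[OF T(1)])
    assume "joined G u v"
    then show "joined T u v"
      using T(2,3) joined_vertices[of G u v] unfolding connected_graph_def
      by (cases "u = v") simp_all
  qed
  with T show "T \<in> spanning_forests G" by (simp add: spanning_forests_def)
next
  fix T
  assume T: "T \<in> spanning_forests G"
  then have "connected_graph T"
    using assms vertices_spanning_forest[OF T]
    by (simp add: connected_graph_def spanning_forests_def)
  with T vertices_spanning_forest[OF T] show "T \<in> spanning_trees G"
    by (simp add: spanning_trees_def tree_def forest_iff_acyclic_edges spanning_forests_def)
qed

text \<open>The edges of \<open>G\<close> that avoid \<open>F\<close> ...\<close>

text \<open>Conditioning on the absence of \<open>F\<close> is deletion. Some forest has to avoid \<open>F\<close>, since otherwise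
  deleting \<open>F\<close> splits a component and the forests of \<open>G - F\<close> are no longer spanning forests of \<open>G\<close>.\<close>

lemma spanning_forests_avoiding:
  assumes "T \<in> spanning_forests G" "T \<inter> F = {}"
  shows "{T \<in> spanning_forests G. T \<inter> F = {}} = spanning_forests (G - F)"
proof -
  have T: "T \<subseteq> G - F" "joined T = joined G" using assms by (auto simp: spanning_forests_def)
  have "joined (G - F) = joined G"
  proof (intro ext iffI)
    fix u v
    show "joined (G - F) u v \<Longrightarrow> joined G u v" by (rule joined_mono) auto
    assume "joined G u v"
    then show "joined (G - F) u v" using T joined_mono by metis
  qed
  then show ?thesis by (auto simp: spanning_forests_def)
qed

section \<open>Flows and Rayleigh monotonicity\<close>

text \<open>A flow of strength \<open>s\<close> from \<open>x\<close> to \<open>y\<close> on the edges of \<open>G\<close>, as an antisymmetric function of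
  ordered pairs of vertices. The finite set \<open>V\<close> is meant to contain the vertices of \<open>G\<close>; as a separate
  parameter it allows flows on different graphs to be compared by sums over the same set.\<close>

definition flow ::
    "(int ^ 'd) set \<Rightarrow> 'd::finite edge set \<Rightarrow> int ^ 'd \<Rightarrow> int ^ 'd \<Rightarrow> real
      \<Rightarrow> (int ^ 'd \<Rightarrow> int ^ 'd \<Rightarrow> real) \<Rightarrow> bool" where
  "flow V G x y s \<theta> \<longleftrightarrow> (\<forall>u v. \<theta> u v = - \<theta> v u) \<and> (\<forall>u v. \<theta> u v \<noteq> 0 \<longrightarrow> adjacent G u v) \<and>
     (\<forall>w. (\<Sum>v\<in>V. \<theta> w v) = s * (of_bool (w = x) - of_bool (w = y)))"

lemma flow_antisym: "flow V G x y s \<theta> \<Longrightarrow> \<theta> u v = - \<theta> v u"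
  and flow_support: "flow V G x y s \<theta> \<Longrightarrow> \<theta> u v \<noteq> 0 \<Longrightarrow> adjacent G u v"
  and flow_divergence:
    "flow V G x y s \<theta> \<Longrightarrow> (\<Sum>v\<in>V. \<theta> w v) = s * (of_bool (w = x) - of_bool (w = y))"
  unfolding flow_def by blast+

lemma flow_mono: "flow V G x y s \<theta> \<Longrightarrow> G \<subseteq> H \<Longrightarrow> flow V H x y s \<theta>"
  unfolding flow_def using adjacent_mono by blast

lemma flow_sum:
  assumes "finite A" "\<And>T. T \<in> A \<Longrightarrow> flow V G x y 1 (\<theta> T)"
  shows "flow V G x y (card A) (\<lambda>u v. \<Sum>T\<in>A. \<theta> T u v)"
  unfolding flow_def
proof (intro conjI allI impI)
  fix u v
  have "\<theta> T u v = - \<theta> T v u" if "T \<in> A" for T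
    using assms(2)[OF that] by (rule flow_antisym)
  then show "(\<Sum>T\<in>A. \<theta> T u v) = - (\<Sum>T\<in>A. \<theta> T v u)"
    by (simp add: sum_negf[symmetric])
  assume "(\<Sum>T\<in>A. \<theta> T u v) \<noteq> 0"
  then obtain T where "T \<in> A" "\<theta> T u v \<noteq> 0" by (meson sum.neutral)
  then show "adjacent G u v" using assms(2) flow_support by metis
next
  fix w
  have "(\<Sum>v\<in>V. \<Sum>T\<in>A. \<theta> T w v) = (\<Sum>T\<in>A. \<Sum>v\<in>V. \<theta> T w v)" by (rule sum.swap)
  also have "\<dots> = (\<Sum>T\<in>A. of_bool (w = x) - of_bool (w = y))"
    by (intro sum.cong refl) (simp add: flow_divergence[OF assms(2)])
  finally show "(\<Sum>v\<in>V. \<Sum>T\<in>A. \<theta> T w v) = real (card A) * (of_bool (w = x) - of_bool (w = y))"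
    by simp
qed

text \<open>Along a path from \<open>x\<close> to \<open>y\<close>, each further step adds a unit on the new edge, which moves the
  sink from its start to its end.\<close>

lemma path_flow_exists:
  fixes G :: "'d::finite edge set"
  assumes V: "finite V" "vertices G \<subseteq> V" and j: "joined G x y"
  shows "\<exists>\<theta>. flow V G x y 1 \<theta>"
  using j
proof (induction rule: rtranclp_induct)
  case base
  show ?case by (rule exI[of _ "\<lambda>_ _. 0"]) (simp add: flow_def)
next
  case (step y z)
  then obtain \<theta> where \<theta>: "flow V G x y 1 \<theta>" by blast
  have yz: "y \<noteq> z" "y \<in> V" "z \<in> V" "adjacent G z y"
    using step.hyps(2) V adjacent_distinct adjacent_vertices adjacent_sym by blast+
  define \<delta> :: "int ^ 'd \<Rightarrow> int ^ 'd \<Rightarrow> real" where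
    "\<delta> = (\<lambda>u v. of_bool (u = y \<and> v = z) - of_bool (u = z \<and> v = y))"
  have \<delta>sum: "(\<Sum>v\<in>V. \<delta> w v) = of_bool (w = y) - of_bool (w = z)" for w
  proof -
    have "(\<Sum>v\<in>V. \<delta> w v) = (\<Sum>v\<in>V. if v = z then of_bool (w = y) else 0)
        - (\<Sum>v\<in>V. if v = y then of_bool (w = z) else 0)"
      unfolding sum_subtractf[symmetric] \<delta>_def by (intro sum.cong) auto
    then show ?thesis using V yz by simp
  qed
  have "flow V G x z 1 (\<lambda>u v. \<theta> u v + \<delta> u v)"
    unfolding flow_def
  proof (intro conjI allI impI)
    fix u v
    show "\<theta> u v + \<delta> u v = - (\<theta> v u + \<delta> v u)"
    proof -
      have "\<delta> u v = - \<delta> v u" by (simp add: \<delta>_def conj_commute)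
      with flow_antisym[OF \<theta>, of u v] show ?thesis by (metis minus_add_distrib)
    qed
    assume "\<theta> u v + \<delta> u v \<noteq> 0"
    then have "\<theta> u v \<noteq> 0 \<or> \<delta> u v \<noteq> 0" by auto
    then show "adjacent G u v"
    proof
      assume "\<delta> u v \<noteq> 0"
      then have "u = y \<and> v = z \<or> u = z \<and> v = y" by (auto simp: \<delta>_def split: if_splits)
      with step.hyps(2) yz show ?thesis by auto
    qed (rule flow_support[OF \<theta>])
  next
    fix w
    show "(\<Sum>v\<in>V. \<theta> w v + \<delta> w v) = 1 * (of_bool (w = x) - of_bool (w = z))"
      by (simp add: sum.distrib \<delta>sum flow_divergence[OF \<theta>])
  qed
  then show ?case by blast
qed

text \<open>Summing the divergence over \<open>A\<close>, the contributions of pairs inside \<open>A\<close> cancel by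
  antisymmetry.\<close>

lemma flow_through_cut:
  assumes V: "finite V" "A \<subseteq> V" "x \<in> V" "y \<in> V" and \<theta>: "flow V G x y s \<theta>"
  shows "(\<Sum>w\<in>A. \<Sum>v\<in>V - A. \<theta> w v) = s * (of_bool (x \<in> A) - of_bool (y \<in> A))"
proof -
  have fA: "finite A" using V finite_subset by blast
  have "(\<Sum>w\<in>A. \<Sum>v\<in>A. \<theta> w v) = (\<Sum>v\<in>A. \<Sum>w\<in>A. \<theta> w v)" by (rule sum.swap)
  also have "\<dots> = (\<Sum>v\<in>A. \<Sum>w\<in>A. - \<theta> v w)"
    by (intro sum.cong refl) (rule flow_antisym[OF \<theta>])
  also have "\<dots> = - (\<Sum>w\<in>A. \<Sum>v\<in>A. \<theta> w v)" by (simp add: sum_negf)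
  finally have inner: "(\<Sum>w\<in>A. \<Sum>v\<in>A. \<theta> w v) = 0" by simp
  have "(\<Sum>w\<in>A. \<Sum>v\<in>V. \<theta> w v) = (\<Sum>w\<in>A. (\<Sum>v\<in>V - A. \<theta> w v) + (\<Sum>v\<in>A. \<theta> w v))"
    using V by (intro sum.cong refl sum.subset_diff) auto
  also have "\<dots> = (\<Sum>w\<in>A. \<Sum>v\<in>V - A. \<theta> w v)" by (simp add: sum.distrib inner)
  finally have "(\<Sum>w\<in>A. \<Sum>v\<in>V - A. \<theta> w v) = (\<Sum>w\<in>A. \<Sum>v\<in>V. \<theta> w v)" by simp
  also have "\<dots> = (\<Sum>w\<in>A. s * (of_bool (w = x) - of_bool (w = y)))"
    by (simp add: flow_divergence[OF \<theta>])
  also have "\<dots> = s * ((\<Sum>w\<in>A. if w = x then 1 else 0) - (\<Sum>w\<in>A. if w = y then 1 else 0))"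
    unfolding sum_distrib_left[symmetric] sum_subtractf by (simp add: of_bool_def)
  also have "\<dots> = s * (of_bool (x \<in> A) - of_bool (y \<in> A))" using fA by simp
  finally show ?thesis .
qed

text \<open>Removing \<open>f\<close> from a forest cuts it into two sides, and only \<open>f\<close> crosses between the side of \<open>u\<close>
  and the rest. The flow through \<open>f\<close> is therefore the flow through this cut, which depends only on the
  sides of \<open>x\<close> and \<open>y\<close>. In particular a forest carries at most one unit flow from \<open>x\<close> to \<open>y\<close>.\<close>

lemma flow_in_forest:
  assumes V: "finite V" "x \<in> V" "y \<in> V" "vertices T \<subseteq> V" and T: "acyclic_edges T"
    and f: "f \<in> T" "ends f = {u, v}" and \<theta>: "flow V T x y 1 \<theta>"
  shows "\<theta> u v = of_bool (joined (T - {f}) u x) - of_bool (joined (T - {f}) u y)"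
proof -
  define A where "A = {w \<in> V. joined (T - {f}) u w}"
  have uv: "u \<in> V" "v \<in> V" using f V by (auto simp: vertices_def)
  have uA: "u \<in> A" using uv by (simp add: A_def)
  have vA: "v \<notin> A" using T f unfolding acyclic_edges_def A_def by blast
  have other: "\<theta> w z = 0" if wz: "w \<in> A" "z \<in> V - A" "(w, z) \<noteq> (u, v)" for w z
  proof (rule ccontr)
    assume "\<theta> w z \<noteq> 0"
    then have "adjacent T w z" by (rule flow_support[OF \<theta>])
    then obtain g where g: "g \<in> T" "ends g = {w, z}" unfolding adjacent_def by blast
    show False
    proof (cases "g = f")
      case True
      then have "{w, z} = {u, v}" using g f by simp
      then show False using wz vA uA by (auto simp: doubleton_eq_iff)
    next
      case False
      then have "adjacent (T - {f}) w z" using g unfolding adjacent_def by blast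
      then have "z \<in> A" using wz unfolding A_def by (auto intro: rtranclp.rtrancl_into_rtrancl)
      then show False using wz by blast
    qed
  qed
  have "(\<Sum>w\<in>A. \<Sum>z\<in>V - A. \<theta> w z) = (\<Sum>p\<in>A \<times> (V - A). \<theta> (fst p) (snd p))"
    by (simp add: sum.cartesian_product case_prod_beta)
  also have "\<dots> = (\<Sum>p\<in>{(u, v)}. \<theta> (fst p) (snd p))"
    using V uA vA uv other by (intro sum.mono_neutral_right) (auto simp: A_def)
  finally have "\<theta> u v = (\<Sum>w\<in>A. \<Sum>z\<in>V - A. \<theta> w z)" by simp
  also have "\<dots> = of_bool (x \<in> A) - of_bool (y \<in> A)"
    using flow_through_cut[OF V(1) _ V(2,3) \<theta>, of A] by (simp add: A_def)
  finally show ?thesis using V by (simp add: A_def)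
qed

text \<open>Suppose \<open>F\<close> lacks just one edge of a spanning forest, and \<open>f\<close> completes it. If \<open>F\<close> also separates
  \<open>x\<close> from \<open>y\<close>, with just one of them on the side of \<open>u\<close>, then \<open>e\<close> reconnects the same two sides and
  completes it too. The identity records the signs: both sides are \<open>1\<close> if \<open>x\<close> is on the side of \<open>u\<close>, and
  \<open>-1\<close> if \<open>x\<close> is on the side of \<open>v\<close>. The statement is symmetric in \<open>e\<close> and \<open>f\<close> up to
  renaming, which gives a bijection.\<close>

lemma spanning_forest_exchange:
  assumes F: "f \<notin> F" "insert f F \<in> spanning_forests G" and f: "ends f = {u, v}"
    and e: "e \<in> G" "ends e = {x, y}" and sep: "joined F u x \<noteq> joined F u y"
  shows "e \<notin> F \<and> insert e F \<in> spanning_forests G \<and>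
    (of_bool (joined F u x) - of_bool (joined F u y) :: real)
      = of_bool (joined F x u) - of_bool (joined F x v)"
proof -
  have FG: "F \<subseteq> G" and ac: "acyclic_edges (insert f F)" and j: "joined (insert f F) = joined G"
    using F by (auto simp: spanning_forests_def)
  have uv: "\<not> joined F u v"
    using ac f F unfolding acyclic_edges_def by (metis Diff_insert_absorb insertI1)
  have xy: "\<not> joined F x y" using sep by (metis joined_sym rtranclp_trans)
  have "joined (insert f F) x y" unfolding j using joined_edge e by blast
  then have cross: "joined F x u \<and> joined F v y \<or> joined F x v \<and> joined F u y"
    using xy unfolding joined_insert[OF f] by blast
  have "joined (insert e F) = joined G"
  proof (intro ext iffI)
    fix p q
    show "joined (insert e F) p q \<Longrightarrow> joined G p q" by (rule joined_mono) (use FG e in auto)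
    have uv': "joined (insert e F) u v"
      unfolding joined_insert[OF e(2)] using cross joined_sym by metis
    assume "joined G p q"
    then have "joined F p q \<or> joined F p u \<and> joined F v q \<or> joined F p v \<and> joined F u q"
      unfolding j[symmetric] joined_insert[OF f] .
    then show "joined (insert e F) p q"
      using uv' joined_mono[of F "insert e F"]
      by (metis joined_sym rtranclp_trans subset_insertI)
  qed
  moreover have "acyclic_edges (insert e F)"
    using acyclic_edges_mono[OF ac] by (intro acyclic_edges_insert[OF _ e(2) xy]) auto
  moreover have "e \<notin> F" using xy joined_edge e by blast
  moreover have "(of_bool (joined F u x) - of_bool (joined F u y) :: real)
      = of_bool (joined F x u) - of_bool (joined F x v)"
  proof -
    have "joined F u x \<and> \<not> joined F u y \<and> joined F x u \<and> \<not> joined F x v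
      \<or> \<not> joined F u x \<and> joined F u y \<and> \<not> joined F x u \<and> joined F x v"
      using cross xy uv by (metis joined_sym rtranclp_trans)
    then show ?thesis by auto
  qed
  ultimately show ?thesis using FG e by (auto simp: spanning_forests_def)
qed

lemma sum_remove_edge:
  "(\<Sum>T\<in>{T \<in> S. g \<in> T}. c (T - {g})) = (\<Sum>F\<in>{F. g \<notin> F \<and> insert g F \<in> S}. c F)"
  by (rule sum.reindex_bij_witness[of _ "insert g" "\<lambda>T. T - {g}"]) (auto simp: insert_absorb)

text \<open>Kirchhoff's description of the electrical current. The flow \<open>\<theta>\<close> adds up the unit flows of all
  spanning forests. The potential \<open>h\<close> counts, among the forests \<open>T\<close> through \<open>e\<close>, those in which the vertex
  stays on the side of \<open>x\<close> after \<open>e\<close> has been removed. Both the current through an edge \<open>f\<close> and the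
  difference of potentials across \<open>f\<close> are signed counts of forests with one edge removed, completed by
  \<open>f\<close> in the first case and by \<open>e\<close> in the second; the exchange of \<open>f\<close> for \<open>e\<close> matches the nonzero terms.\<close>

lemma kirchhoff_current:
  fixes G :: "'d::finite edge set"
  assumes G: "finite G" and e: "e \<in> G" "ends e = {x, y}"
    and V: "finite V" "vertices G \<subseteq> V"
  obtains \<theta> h where "flow V G x y (card (spanning_forests G)) \<theta>"
    and "\<And>u v. adjacent G u v \<Longrightarrow> \<theta> u v = h u - h v"
    and "h x - h y = card {T \<in> spanning_forests G. e \<in> T}"
proof -
  let ?S = "spanning_forests G"
  have fin: "finite ?S" by (rule finite_spanning_forests[OF G])
  have xy: "x \<in> V" "y \<in> V" using e V by (auto simp: vertices_def)
  have "\<exists>\<theta>. flow V T x y 1 \<theta>" if "T \<in> ?S" for T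
  proof (rule path_flow_exists[OF V(1)])
    show "vertices T \<subseteq> V" using vertices_spanning_forest[OF that] V by simp
    show "joined T x y" using that joined_edge[OF e] by (simp add: spanning_forests_def)
  qed
  then obtain \<theta> where \<theta>: "\<And>T. T \<in> ?S \<Longrightarrow> flow V T x y 1 (\<theta> T)" by metis
  define I where "I = (\<lambda>u v. \<Sum>T\<in>?S. \<theta> T u v)"
  define h where "h = (\<lambda>u. \<Sum>T\<in>{T \<in> ?S. e \<in> T}. of_bool (joined (T - {e}) x u) :: real)"
  have "flow V G x y (card ?S) I"
    unfolding I_def
  proof (rule flow_sum[OF fin])
    show "flow V G x y 1 (\<theta> T)" if "T \<in> ?S" for T
      by (rule flow_mono[OF \<theta>[OF that]]) (use that in \<open>simp add: spanning_forests_def\<close>)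
  qed
  moreover have "I u v = h u - h v" if uv: "adjacent G u v" for u v
  proof -
    from uv obtain f where f: "f \<in> G" "ends f = {u, v}" unfolding adjacent_def by blast
    define R where "R = (\<lambda>g. {F. g \<notin> F \<and> insert g F \<in> ?S})"
    have finR: "finite (R g)" for g
      by (rule finite_subset[of _ "Pow G"]) (auto simp: R_def spanning_forests_def G)
    \<comment> \<open>The contributions of an edge set \<open>F\<close> with one edge missing: to the current through \<open>f\<close>
      and to the difference of potentials across \<open>f\<close>.\<close>
    define c where "c = (\<lambda>F. of_bool (joined F u x) - of_bool (joined F u y) :: real)"
    define d where "d = (\<lambda>F. of_bool (joined F x u) - of_bool (joined F x v) :: real)"
    have "I u v = (\<Sum>T\<in>{T \<in> ?S. f \<in> T}. \<theta> T u v)"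
      unfolding I_def
    proof (rule sum.mono_neutral_right[OF fin], blast, intro ballI)
      fix T
      assume T: "T \<in> ?S - {T \<in> ?S. f \<in> T}"
      have "\<not> adjacent T u v"
      proof
        assume "adjacent T u v"
        then obtain g where "g \<in> T" "ends g = {u, v}" unfolding adjacent_def by blast
        moreover from this f have "g = f" by (simp add: ends_inject[symmetric])
        ultimately show False using T by blast
      qed
      then show "\<theta> T u v = 0" using flow_support[OF \<theta>] T by blast
    qed
    also have "\<dots> = (\<Sum>T\<in>{T \<in> ?S. f \<in> T}. c (T - {f}))"
    proof (rule sum.cong[OF refl])
      fix T
      assume T: "T \<in> {T \<in> ?S. f \<in> T}"
      then have TS: "T \<in> ?S" by blast
      have "vertices T \<subseteq> V" using vertices_spanning_forest[OF TS] V by simp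
      moreover have "acyclic_edges T" using TS by (simp add: spanning_forests_def)
      ultimately show "\<theta> T u v = c (T - {f})"
        unfolding c_def using flow_in_forest[OF V(1) xy _ _ _ f(2) \<theta>[OF TS]] T by blast
    qed
    also have "\<dots> = (\<Sum>F\<in>R f. c F)" unfolding R_def by (rule sum_remove_edge)
    also have "\<dots> = (\<Sum>F\<in>{F \<in> R f. c F \<noteq> 0}. c F)"
      by (rule sum.mono_neutral_right[OF finR]) auto
    also have "\<dots> = (\<Sum>F\<in>{F \<in> R e. d F \<noteq> 0}. d F)"
    proof (rule sum.cong)
      have *: "F \<in> R e \<and> c F = d F" if "F \<in> R f" "c F \<noteq> 0" for F
      proof -
        have "joined F u x \<noteq> joined F u y" using that(2) by (auto simp: c_def)
        moreover have "f \<notin> F" "insert f F \<in> ?S" using that(1) by (simp_all add: R_def)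
        ultimately show ?thesis
          using spanning_forest_exchange[OF _ _ f(2) e]
          by (simp only: R_def c_def d_def mem_Collect_eq conj_assoc)
      qed
      have **: "F \<in> R f \<and> d F = c F" if "F \<in> R e" "d F \<noteq> 0" for F
      proof -
        have "joined F x u \<noteq> joined F x v" using that(2) by (auto simp: d_def)
        moreover have "e \<notin> F" "insert e F \<in> ?S" using that(1) by (simp_all add: R_def)
        ultimately show ?thesis
          using spanning_forest_exchange[OF _ _ e(2) f]
          by (simp only: R_def c_def d_def mem_Collect_eq conj_assoc)
      qed
      show "{F \<in> R f. c F \<noteq> 0} = {F \<in> R e. d F \<noteq> 0}"
        by (rule Collect_cong) (metis * **)
      show "c F = d F" if "F \<in> {F \<in> R e. d F \<noteq> 0}" for F using **[of F] that by simp
    qed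
    also have "\<dots> = (\<Sum>F\<in>R e. d F)"
      by (rule sum.mono_neutral_left[OF finR]) auto
    also have "\<dots> = (\<Sum>T\<in>{T \<in> ?S. e \<in> T}. d (T - {e}))"
      unfolding R_def by (rule sum_remove_edge[symmetric])
    also have "\<dots> = h u - h v" by (simp add: h_def d_def sum_subtractf)
    finally show ?thesis .
  qed
  moreover have "h x - h y = card {T \<in> ?S. e \<in> T}"
  proof -
    have "h y = 0"
      unfolding h_def
    proof (intro sum.neutral ballI)
      fix T
      assume "T \<in> {T \<in> ?S. e \<in> T}"
      then have "\<not> joined (T - {e}) x y"
        using e by (auto simp: spanning_forests_def acyclic_edges_def)
      then show "of_bool (joined (T - {e}) x y) = (0::real)" by simp
    qed
    moreover have "h x = card {T \<in> ?S. e \<in> T}" by (simp add: h_def)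
    ultimately show ?thesis by simp
  qed
  ultimately show ?thesis by (rule that)
qed

text \<open>Summation by parts: against a gradient, only the divergence of a flow matters. So
  the pairing is the same for all flows of the same strength, which is why a flow that is itself a
  gradient has least energy.\<close>

lemma flow_gradient:
  assumes V: "finite V" "x \<in> V" "y \<in> V" and \<theta>: "flow V G x y s \<theta>"
    and \<phi>: "\<And>u v. adjacent G u v \<Longrightarrow> \<phi> u v = h u - h v"
  shows "(\<Sum>u\<in>V. \<Sum>v\<in>V. \<theta> u v * \<phi> u v) = 2 * s * (h x - h y)"
proof -
  have "\<theta> u v * \<phi> u v = \<theta> u v * h u - \<theta> u v * h v" for u v
    using \<phi>[of u v] flow_support[OF \<theta>, of u v]
    by (cases "\<theta> u v = 0") (simp_all add: right_diff_distrib)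
  then have "(\<Sum>u\<in>V. \<Sum>v\<in>V. \<theta> u v * \<phi> u v)
      = (\<Sum>u\<in>V. \<Sum>v\<in>V. \<theta> u v * h u) - (\<Sum>u\<in>V. \<Sum>v\<in>V. \<theta> u v * h v)"
    by (simp add: sum_subtractf)
  also have "(\<Sum>u\<in>V. \<Sum>v\<in>V. \<theta> u v * h v) = (\<Sum>v\<in>V. \<Sum>u\<in>V. \<theta> u v * h v)"
    by (rule sum.swap)
  also have "\<dots> = (\<Sum>v\<in>V. \<Sum>u\<in>V. - (\<theta> v u * h v))"
    by (intro sum.cong refl) (subst flow_antisym[OF \<theta>], simp)
  also have "\<dots> = - (\<Sum>u\<in>V. \<Sum>v\<in>V. \<theta> u v * h u)" by (simp add: sum_negf)
  also have "(\<Sum>u\<in>V. \<Sum>v\<in>V. \<theta> u v * h u) = (\<Sum>u\<in>V. s * (of_bool (u = x) - of_bool (u = y)) * h u)"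
    by (simp add: sum_distrib_right[symmetric] flow_divergence[OF \<theta>])
  also have "\<dots> = s * ((\<Sum>u\<in>V. if u = x then h u else 0) - (\<Sum>u\<in>V. if u = y then h u else 0))"
    unfolding sum_subtractf[symmetric] sum_distrib_left by (intro sum.cong) auto
  also have "\<dots> = s * (h x - h y)" using V by simp
  finally show ?thesis by simp
qed

text \<open>The two unit currents, in \<open>G\<close> and in \<open>H\<close>, are compared by expanding the energy of their
  difference. The cross term pairs a unit flow on \<open>H\<close> with the gradient of \<open>H\<close>, so it equals the energy of
  the current in \<open>H\<close>, and the nonnegative energy of the difference is that of \<open>G\<close> minus that of \<open>H\<close>.\<close>

lemma rayleigh_monotonicity:
  fixes G H :: "'d::finite edge set"
  assumes H: "finite H" and GH: "G \<subseteq> H" and e: "e \<in> G"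
  shows "card {T \<in> spanning_forests H. e \<in> T} / card (spanning_forests H)
    \<le> card {T \<in> spanning_forests G. e \<in> T} / card (spanning_forests G)"
proof -
  define N where "N = real (card (spanning_forests G))"
  define N' where "N' = real (card (spanning_forests H))"
  define p where "p = real (card {T \<in> spanning_forests G. e \<in> T})"
  define q where "q = real (card {T \<in> spanning_forests H. e \<in> T})"
  define V where "V = vertices H"
  have G: "finite G" by (rule finite_subset[OF GH H])
  have pos: "0 < N" "0 < N'"
    using card_spanning_forests_pos[OF G] card_spanning_forests_pos[OF H]
    by (simp_all add: N_def N'_def)
  obtain x y where xy: "ends e = {x, y}" by (rule ends_cases)
  have V: "finite V" "vertices G \<subseteq> V" "vertices H \<subseteq> V"
    using finite_vertices[OF H] vertices_mono[OF GH] by (auto simp: V_def)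
  have eH: "e \<in> H" using e GH by blast
  have xyV: "x \<in> V" "y \<in> V" using eH xy by (auto simp: V_def vertices_def)
  obtain \<theta> h where \<theta>: "flow V G x y N \<theta>"
    and h: "\<And>u v. adjacent G u v \<Longrightarrow> \<theta> u v = h u - h v" and hp: "h x - h y = p"
    by (rule kirchhoff_current[OF G e xy V(1,2), folded N_def p_def]) blast
  obtain \<phi> k where \<phi>: "flow V H x y N' \<phi>"
    and k: "\<And>u v. adjacent H u v \<Longrightarrow> \<phi> u v = k u - k v" and kq: "k x - k y = q"
    by (rule kirchhoff_current[OF H eH xy V(1,3), folded N'_def q_def]) blast
  have \<theta>\<theta>: "(\<Sum>u\<in>V. \<Sum>v\<in>V. \<theta> u v * \<theta> u v) = 2 * N * p"
    using flow_gradient[OF V(1) xyV \<theta> h] hp by simp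
  have \<theta>\<phi>: "(\<Sum>u\<in>V. \<Sum>v\<in>V. \<theta> u v * \<phi> u v) = 2 * N * q"
    using flow_gradient[OF V(1) xyV flow_mono[OF \<theta> GH] k] kq by simp
  have \<phi>\<phi>: "(\<Sum>u\<in>V. \<Sum>v\<in>V. \<phi> u v * \<phi> u v) = 2 * N' * q"
    using flow_gradient[OF V(1) xyV \<phi> k] kq by simp
  have "0 \<le> (\<Sum>u\<in>V. \<Sum>v\<in>V. (\<theta> u v / N - \<phi> u v / N')\<^sup>2)"
    by (intro sum_nonneg) simp
  also have "\<dots> = (\<Sum>u\<in>V. \<Sum>v\<in>V. (1 / N\<^sup>2) * (\<theta> u v * \<theta> u v)
      - (2 / (N * N')) * (\<theta> u v * \<phi> u v) + (1 / N'\<^sup>2) * (\<phi> u v * \<phi> u v))"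
    using pos by (intro sum.cong refl) (simp add: power2_eq_square field_simps)
  also have "\<dots> = (1 / N\<^sup>2) * (2 * N * p) - (2 / (N * N')) * (2 * N * q) + (1 / N'\<^sup>2) * (2 * N' * q)"
    unfolding sum.distrib sum_subtractf sum_distrib_left[symmetric] \<theta>\<theta> \<theta>\<phi> \<phi>\<phi> ..
  also have "\<dots> = 2 * (p / N - q / N')"
    using pos by (simp add: power2_eq_square field_simps)
  finally show ?thesis by (simp add: p_def q_def N_def N'_def)
qed

section \<open>Convergence along finite graphs\<close>

definition forest_prob :: "'d::finite edge set \<Rightarrow> 'd lattice_subgraph set \<Rightarrow> real" where
  "forest_prob G C = card {T \<in> spanning_forests G. (\<lambda>e. e \<in> T) \<in> C} / card (spanning_forests G)"

definition pattern :: "'d::finite edge set \<Rightarrow> 'd edge set \<Rightarrow> 'd lattice_subgraph set" where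
  "pattern A S = {\<omega>. (\<forall>e\<in>A. \<not> \<omega> e) \<and> (\<forall>e\<in>S. \<omega> e)}"

lemma forest_prob_nonneg: "0 \<le> forest_prob G C"
  by (simp add: forest_prob_def)

lemma forest_prob_empty: "forest_prob G {} = 0"
  by (simp add: forest_prob_def)

lemma forest_prob_UNIV: "finite G \<Longrightarrow> forest_prob G UNIV = 1"
  using card_spanning_forests_pos[of G] by (simp add: forest_prob_def)

lemma forest_prob_Un:
  assumes "finite G" "C \<inter> D = {}"
  shows "forest_prob G (C \<union> D) = forest_prob G C + forest_prob G D"
proof -
  have "{T \<in> spanning_forests G. (\<lambda>e. e \<in> T) \<in> C \<union> D}
    = {T \<in> spanning_forests G. (\<lambda>e. e \<in> T) \<in> C} \<union> {T \<in> spanning_forests G. (\<lambda>e. e \<in> T) \<in> D}"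
    by blast
  moreover have "card \<dots> = card {T \<in> spanning_forests G. (\<lambda>e. e \<in> T) \<in> C}
      + card {T \<in> spanning_forests G. (\<lambda>e. e \<in> T) \<in> D}"
    using assms by (intro card_Un_disjoint) (auto simp: finite_spanning_forests)
  ultimately show ?thesis by (simp add: forest_prob_def add_divide_distrib)
qed

lemma forest_prob_le_1:
  assumes "finite G"
  shows "forest_prob G C \<le> 1"
  using forest_prob_Un[OF assms, of C "- C"] forest_prob_UNIV[OF assms] forest_prob_nonneg[of G "- C"]
  by simp

lemma forest_prob_UN:
  assumes G: "finite G" and A: "finite A" "disjoint_family_on C A"
  shows "forest_prob G (\<Union>i\<in>A. C i) = (\<Sum>i\<in>A. forest_prob G (C i))"
  using A
proof (induction A rule: finite_induct)
  case empty
  then show ?case by (simp add: forest_prob_empty)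
next
  case (insert i A)
  then have "C i \<inter> (\<Union>j\<in>A. C j) = {}" "disjoint_family_on C A"
    by (auto simp: disjoint_family_on_def)
  with insert show ?case by (simp add: forest_prob_Un[OF G])
qed

text \<open>By induction on \<open>F\<close>: the conditional probability that the next edge \<open>e\<close> is absent, given that
  \<open>F\<close> is avoided, is its probability in the graph without \<open>F\<close>, and Rayleigh monotonicity applies to these
  smaller graphs. The edges of \<open>F\<close> must lie in \<open>G\<close>: an edge outside \<open>G\<close> is avoided with probability
  one, which drops when the edge is added.\<close>

lemma forest_prob_avoid_mono:
  fixes G H :: "'d::finite edge set"
  assumes H: "finite H" and GH: "G \<subseteq> H" and F: "F \<subseteq> G"
  shows "forest_prob G (pattern F {}) \<le> forest_prob H (pattern F {})"
proof -
  have avoid: "{T \<in> spanning_forests K. (\<lambda>e. e \<in> T) \<in> pattern D {}}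
      = {T \<in> spanning_forests K. T \<inter> D = {}}" for K D :: "'d edge set"
    by (auto simp: pattern_def)
  have step: "forest_prob K (pattern (insert e D) {})
      = forest_prob K (pattern D {})
        * (1 - card {T \<in> spanning_forests (K - D). e \<in> T} / card (spanning_forests (K - D)))"
    if K: "finite K" and T: "T \<in> spanning_forests K" "T \<inter> D = {}" for K D T and e :: "'d edge"
  proof -
    let ?S = "spanning_forests (K - D)"
    have S: "{T \<in> spanning_forests K. T \<inter> D = {}} = ?S"
      using T by (rule spanning_forests_avoiding)
    have fin: "finite ?S" and pos: "0 < card ?S"
      using K by (auto intro: finite_spanning_forests card_spanning_forests_pos)
    have "{T \<in> spanning_forests K. T \<inter> insert e D = {}} = ?S - {T \<in> ?S. e \<in> T}"
      using S by blast
    then have count: "real (card {T \<in> spanning_forests K. T \<inter> insert e D = {}})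
        = real (card ?S) - real (card {T \<in> ?S. e \<in> T})"
      using fin by (simp add: card_Diff_subset of_nat_diff card_mono)
    have split: "(s - b) / k = s / k * (1 - b / s)" if "0 < s" for s b k :: real
    proof -
      have "s * (1 - b / s) = s - b" using that by (simp add: right_diff_distrib)
      then show ?thesis by (metis times_divide_eq_left)
    qed
    show ?thesis
      unfolding forest_prob_def avoid S count
      by (rule split[of "real (card ?S)" _ "real (card (spanning_forests K))"]) (use pos in simp)
  qed
  have "finite F" by (rule finite_subset[OF subset_trans[OF F GH] H])
  then show ?thesis
    using F
  proof (induction F rule: finite_induct)
    case empty
    show ?case using H finite_subset[OF GH H] by (simp add: pattern_def forest_prob_UNIV)
  next
    case (insert e F)
    have G: "finite G" by (rule finite_subset[OF GH H])
    have IH: "forest_prob G (pattern F {}) \<le> forest_prob H (pattern F {})" using insert by blast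
    show ?case
    proof (cases "\<exists>T\<in>spanning_forests G. T \<inter> F = {}")
      \<comment> \<open>Deleting \<open>F\<close> splits a component of \<open>G\<close>, so the left-hand side vanishes.\<close>
      case False
      then have "{T \<in> spanning_forests G. T \<inter> insert e F = {}} = {}" by blast
      then have "forest_prob G (pattern (insert e F) {}) = 0"
        unfolding forest_prob_def avoid by (simp only: card.empty of_nat_0 div_0)
      then show ?thesis using forest_prob_nonneg by simp
    next
      case True
      then obtain T where T: "T \<in> spanning_forests G" "T \<inter> F = {}" by blast
      then have "0 < forest_prob G (pattern F {})"
        unfolding forest_prob_def avoid using G
        by (intro divide_pos_pos) (auto simp: card_gt_0_iff finite_spanning_forests)
      \<comment> \<open>The induction hypothesis also shows that \<open>H\<close> has a spanning forest that avoids \<open>F\<close>.\<close>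
      then have "0 < forest_prob H (pattern F {})" using IH by linarith
      then have "{T \<in> spanning_forests H. T \<inter> F = {}} \<noteq> {}"
        unfolding forest_prob_def avoid by (metis card.empty div_0 less_irrefl of_nat_0)
      then obtain T' where T': "T' \<in> spanning_forests H" "T' \<inter> F = {}" by blast
      have ray: "card {T \<in> spanning_forests (H - F). e \<in> T} / card (spanning_forests (H - F))
          \<le> card {T \<in> spanning_forests (G - F). e \<in> T} / card (spanning_forests (G - F))"
        using H GH insert by (intro rayleigh_monotonicity) auto
      have "card {T \<in> spanning_forests (G - F). e \<in> T} \<le> card (spanning_forests (G - F))"
        using G by (intro card_mono finite_spanning_forests) auto
      then have le1: "card {T \<in> spanning_forests (G - F). e \<in> T} / card (spanning_forests (G - F)) \<le> 1"
        by (auto simp: divide_le_eq_1)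
      show ?thesis
        unfolding step[OF G T] step[OF H T']
        using IH ray le1 by (intro mult_mono) (auto simp: forest_prob_nonneg)
    qed
  qed
qed

lemma monotone_tendsto_finite_subsets:
  fixes f :: "'a set \<Rightarrow> real"
  assumes F: "finite F" and bdd: "\<And>G. finite G \<Longrightarrow> f G \<le> c"
    and mono: "\<And>G H. finite H \<Longrightarrow> F \<subseteq> G \<Longrightarrow> G \<subseteq> H \<Longrightarrow> f G \<le> f H"
  shows "\<exists>l. (f \<longlongrightarrow> l) (finite_subsets_at_top UNIV)"
proof
  let ?A = "{G. finite G \<and> F \<subseteq> G}"
  have ne: "f ` ?A \<noteq> {}" using F by blast
  have bd: "bdd_above (f ` ?A)" using bdd by (auto intro!: bdd_aboveI)
  show "(f \<longlongrightarrow> (SUP G\<in>?A. f G)) (finite_subsets_at_top UNIV)"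
  proof (rule order_tendstoI)
    fix a
    assume "a < (SUP G\<in>?A. f G)"
    then obtain G where G: "finite G" "F \<subseteq> G" "a < f G"
      using less_cSUP_iff[OF _ bd, of a] ne by auto
    then have "a < f H" if "finite H" "G \<subseteq> H" for H
      using mono[OF that(1) G(2) that(2)] by linarith
    then show "\<forall>\<^sub>F H in finite_subsets_at_top UNIV. a < f H"
      unfolding eventually_finite_subsets_at_top using G by blast
  next
    fix a
    assume a: "(SUP G\<in>?A. f G) < a"
    have "f H < a" if "finite H" "F \<subseteq> H" for H
      using cSUP_upper[OF _ bd, of H] that a by simp
    then show "\<forall>\<^sub>F H in finite_subsets_at_top UNIV. f H < a"
      unfolding eventually_finite_subsets_at_top using F by blast
  qed
qed

text \<open>Inclusion and exclusion one edge at a time: requiring \<open>s\<close> to be present is the difference of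
  requiring nothing of \<open>s\<close> and requiring it to be absent.\<close>

lemma forest_prob_pattern_converges:
  fixes A S :: "'d::finite edge set"
  assumes "finite A" "finite S"
  shows "\<exists>l. ((\<lambda>G. forest_prob G (pattern A S)) \<longlongrightarrow> l) (finite_subsets_at_top UNIV)"
  using assms(2,1)
proof (induction S arbitrary: A rule: finite_induct)
  case empty
  show ?case
    by (rule monotone_tendsto_finite_subsets[OF empty, where c = 1])
      (auto intro: forest_prob_le_1 forest_prob_avoid_mono)
next
  case (insert s S)
  obtain l m where l: "((\<lambda>G. forest_prob G (pattern A S)) \<longlongrightarrow> l) (finite_subsets_at_top UNIV)"
    and m: "((\<lambda>G. forest_prob G (pattern (insert s A) S)) \<longlongrightarrow> m) (finite_subsets_at_top UNIV)"
    using insert.IH[of A] insert.IH[of "insert s A"] insert.prems by auto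
  have "forest_prob G (pattern A S) - forest_prob G (pattern (insert s A) S)
      = forest_prob G (pattern A (insert s S))" if "finite G" for G
  proof -
    have "pattern A S = pattern A (insert s S) \<union> pattern (insert s A) S"
      "pattern A (insert s S) \<inter> pattern (insert s A) S = {}"
      by (auto simp: pattern_def)
    then show ?thesis using forest_prob_Un[OF that] by simp
  qed
  then have "\<forall>\<^sub>F G in finite_subsets_at_top UNIV.
      forest_prob G (pattern A S) - forest_prob G (pattern (insert s A) S)
      = forest_prob G (pattern A (insert s S))"
    by blast
  from Lim_transform_eventually[OF tendsto_diff[OF l m] this] show ?case by blast
qed

lemma cylinder_eventE:
  assumes "cylinder_event C"
  obtains F where "finite F"
    and "\<And>\<omega> \<omega>'. \<forall>e\<in>F. \<omega> e = \<omega>' e \<Longrightarrow> \<omega> \<in> C \<longleftrightarrow> \<omega>' \<in> C"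
proof -
  from assms obtain F where "finite F"
    and F: "\<forall>\<omega> \<omega>'. (\<forall>e\<in>F. \<omega> e = \<omega>' e) \<longrightarrow> (\<omega> \<in> C \<longleftrightarrow> \<omega>' \<in> C)"
    unfolding cylinder_event_def by (elim exE conjE)
  from this(1) show ?thesis by (rule that) (rule F[rule_format], blast)
qed

lemma cylinder_event_eq_patterns:
  assumes "cylinder_event C"
  obtains F where "finite F" "C = (\<Union>S\<in>{S. S \<subseteq> F \<and> (\<lambda>e. e \<in> S) \<in> C}. pattern (F - S) S)"
proof -
  from assms obtain F where F: "finite F"
    "\<And>\<omega> \<omega>'. \<forall>e\<in>F. \<omega> e = \<omega>' e \<Longrightarrow> \<omega> \<in> C \<longleftrightarrow> \<omega>' \<in> C"
    by (rule cylinder_eventE) blast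
  have "C = (\<Union>S\<in>{S. S \<subseteq> F \<and> (\<lambda>e. e \<in> S) \<in> C}. pattern (F - S) S)"
  proof (intro set_eqI iffI)
    fix \<omega>
    assume \<omega>: "\<omega> \<in> C"
    define S where "S = {e \<in> F. \<omega> e}"
    have "(\<lambda>e. e \<in> S) \<in> C" using F(2)[of "\<lambda>e. e \<in> S" \<omega>] \<omega> by (simp add: S_def)
    moreover have "\<omega> \<in> pattern (F - S) S" "S \<subseteq> F" by (auto simp: S_def pattern_def)
    ultimately show "\<omega> \<in> (\<Union>S\<in>{S. S \<subseteq> F \<and> (\<lambda>e. e \<in> S) \<in> C}. pattern (F - S) S)" by blast
  next
    fix \<omega>
    assume "\<omega> \<in> (\<Union>S\<in>{S. S \<subseteq> F \<and> (\<lambda>e. e \<in> S) \<in> C}. pattern (F - S) S)"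
    then obtain S where S: "S \<subseteq> F" "(\<lambda>e. e \<in> S) \<in> C" "\<omega> \<in> pattern (F - S) S" by blast
    then show "\<omega> \<in> C" using F(2)[of "\<lambda>e. e \<in> S" \<omega>] by (auto simp: pattern_def)
  qed
  with F(1) show ?thesis by (rule that)
qed

lemma forest_prob_converges:
  fixes C :: "'d::finite lattice_subgraph set"
  assumes "cylinder_event C"
  shows "\<exists>l. ((\<lambda>G. forest_prob G C) \<longlongrightarrow> l) (finite_subsets_at_top UNIV)"
proof -
  from assms obtain F where F: "finite F"
    and C: "C = (\<Union>S\<in>{S. S \<subseteq> F \<and> (\<lambda>e. e \<in> S) \<in> C}. pattern (F - S) S)"
    by (rule cylinder_event_eq_patterns)
  define K where "K = {S. S \<subseteq> F \<and> (\<lambda>e. e \<in> S) \<in> C}"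
  have K: "finite K" using F by (simp add: K_def)
  have sub: "S \<subseteq> F" if "S \<in> K" for S using that by (simp add: K_def)
  have disj: "disjoint_family_on (\<lambda>S. pattern (F - S) S) K"
    unfolding disjoint_family_on_def
  proof (intro ballI impI)
    fix S S'
    assume "S \<in> K" "S' \<in> K" "S \<noteq> S'"
    then obtain e where "e \<in> F" "e \<in> S \<longleftrightarrow> e \<notin> S'" using sub by blast
    then show "pattern (F - S) S \<inter> pattern (F - S') S' = {}" by (auto simp: pattern_def)
  qed
  have "\<exists>l. ((\<lambda>G. forest_prob G (pattern (F - S) S)) \<longlongrightarrow> l) (finite_subsets_at_top UNIV)"
    if "S \<in> K" for S
    using F finite_subset[OF sub[OF that] F] by (intro forest_prob_pattern_converges) auto
  then obtain l where l: "\<And>S. S \<in> K \<Longrightarrow>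
      ((\<lambda>G. forest_prob G (pattern (F - S) S)) \<longlongrightarrow> l S) (finite_subsets_at_top UNIV)"
    by metis
  have lim: "((\<lambda>G. \<Sum>S\<in>K. forest_prob G (pattern (F - S) S)) \<longlongrightarrow> (\<Sum>S\<in>K. l S))
      (finite_subsets_at_top UNIV)"
    by (intro tendsto_sum l)
  have "(\<Sum>S\<in>K. forest_prob G (pattern (F - S) S)) = forest_prob G C" if "finite G" for G
    using forest_prob_UN[OF that K disj] C unfolding K_def by simp
  then have eq: "\<forall>\<^sub>F G in finite_subsets_at_top UNIV.
      (\<Sum>S\<in>K. forest_prob G (pattern (F - S) S)) = forest_prob G C"
    by blast
  show ?thesis by (rule exI) (rule Lim_transform_eventually[OF lim eq])
qed

text \<open>The candidate for the limiting measure. The limit is along the net of all finite edge sets, so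
  no exhausting sequence is singled out.\<close>

definition lattice_prob :: "'d::finite lattice_subgraph set \<Rightarrow> real" where
  "lattice_prob C = Lim (finite_subsets_at_top UNIV) (\<lambda>G. forest_prob G C)"

lemma tendsto_lattice_prob:
  assumes "cylinder_event C"
  shows "((\<lambda>G. forest_prob G C) \<longlongrightarrow> lattice_prob C) (finite_subsets_at_top UNIV)"
  using forest_prob_converges[OF assms] tendsto_Lim[OF finite_subsets_at_top_neq_bot]
  unfolding lattice_prob_def by metis

lemma lattice_prob_eqI:
  assumes "cylinder_event C" "((\<lambda>G. forest_prob G C) \<longlongrightarrow> l) (finite_subsets_at_top UNIV)"
  shows "lattice_prob C = l"
  using tendsto_unique[OF finite_subsets_at_top_neq_bot tendsto_lattice_prob[OF assms(1)] assms(2)] .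

section \<open>The limiting measure\<close>

lemma cylinder_event_empty: "cylinder_event {}"
  unfolding cylinder_event_def by blast

lemma cylinder_event_Compl: "cylinder_event C \<Longrightarrow> cylinder_event (- C)"
  unfolding cylinder_event_def by simp

lemma cylinder_event_Un:
  assumes "cylinder_event C" "cylinder_event D"
  shows "cylinder_event (C \<union> D)"
proof -
  obtain F where F: "finite F" "\<And>\<omega> \<omega>'. \<forall>e\<in>F. \<omega> e = \<omega>' e \<Longrightarrow> \<omega> \<in> C \<longleftrightarrow> \<omega>' \<in> C"
    using assms(1) by (rule cylinder_eventE) blast
  obtain K where K: "finite K" "\<And>\<omega> \<omega>'. \<forall>e\<in>K. \<omega> e = \<omega>' e \<Longrightarrow> \<omega> \<in> D \<longleftrightarrow> \<omega>' \<in> D"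
    using assms(2) by (rule cylinder_eventE) blast
  have "\<omega> \<in> C \<union> D \<longleftrightarrow> \<omega>' \<in> C \<union> D" if "\<forall>e\<in>F \<union> K. \<omega> e = \<omega>' e" for \<omega> \<omega>'
  proof -
    have "\<omega> \<in> C \<longleftrightarrow> \<omega>' \<in> C" by (rule F(2)) (use that in blast)
    moreover have "\<omega> \<in> D \<longleftrightarrow> \<omega>' \<in> D" by (rule K(2)) (use that in blast)
    ultimately show ?thesis by simp
  qed
  then show ?thesis
    unfolding cylinder_event_def using F(1) K(1) by (intro exI[of _ "F \<union> K"]) simp
qed

lemma algebra_cylinder_events: "algebra UNIV {C :: 'd::finite lattice_subgraph set. cylinder_event C}"
  unfolding algebra_iff_Un
  by (auto simp: cylinder_event_empty cylinder_event_Un Compl_eq_Diff_UNIV[symmetric]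
      intro: cylinder_event_Compl)

lemma cylinder_event_pattern: "finite A \<Longrightarrow> finite S \<Longrightarrow> cylinder_event (pattern A S)"
  unfolding cylinder_event_def pattern_def by (intro exI[of _ "A \<union> S"]) auto

lemma open_pattern:
  fixes A S :: "'d::finite edge set"
  assumes "finite A" "finite S"
  shows "open (pattern A S)"
proof -
  have co: "open {\<omega> :: 'd lattice_subgraph. \<omega> e \<in> B}" for e B
    using open_vimage[OF open_bool[of B] continuous_on_product_coordinates[of e]]
    by (simp add: vimage_def)
  have "pattern A S = (\<Inter>e\<in>A. {\<omega>. \<omega> e \<in> {False}}) \<inter> (\<Inter>e\<in>S. {\<omega>. \<omega> e \<in> {True}})"
    by (auto simp: pattern_def)
  also have "open \<dots>" using assms co by (intro open_Int open_INT ballI) blast+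
  finally show ?thesis .
qed

lemma open_cylinder_event:
  assumes "cylinder_event C"
  shows "open C"
proof -
  from assms obtain F where F: "finite F"
    and C: "C = (\<Union>S\<in>{S. S \<subseteq> F \<and> (\<lambda>e. e \<in> S) \<in> C}. pattern (F - S) S)"
    by (rule cylinder_event_eq_patterns)
  show ?thesis
    by (subst C) (use F in \<open>auto intro!: open_UN open_pattern intro: finite_subset\<close>)
qed

lemma compact_UNIV_subgraphs: "compact (UNIV :: 'd::finite lattice_subgraph set)"
proof -
  have "compact_space (euclidean :: bool topology)"
    unfolding compact_space_def by (simp add: finite_imp_compact)
  then have "compact_space (product_topology (\<lambda>_. euclidean :: bool topology) (UNIV :: 'd edge set))"
    by (simp add: compact_space_product_topology)
  then have "compact_space (euclidean :: 'd lattice_subgraph topology)"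
    by (simp add: euclidean_product_topology)
  then show ?thesis by (simp add: compact_space_def)
qed

text \<open>Cylinder events are closed subsets of a compact space, by their openness and complementation.
  This is what turns finite additivity into countable additivity.\<close>

lemma decreasing_cylinder_events:
  fixes A :: "nat \<Rightarrow> 'd::finite lattice_subgraph set"
  assumes cyl: "\<And>n. cylinder_event (A n)" and dec: "decseq A" and inter: "(\<Inter>n. A n) = {}"
  shows "\<exists>n. A n = {}"
proof (rule ccontr)
  assume ne: "\<nexists>n. A n = {}"
  have "UNIV \<inter> (\<Inter>n. A n) \<noteq> {}"
  proof (rule compact_imp_fip_image[OF compact_UNIV_subgraphs])
    show "closed (A n)" for n
      using open_cylinder_event[OF cylinder_event_Compl[OF cyl[of n]]] by (simp add: closed_def)
    fix I :: "nat set"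
    assume I: "finite I" "I \<subseteq> UNIV"
    \<comment> \<open>The element \<open>0\<close> is inserted so that the maximum exists also for empty \<open>I\<close>.\<close>
    have "A (Max (insert 0 I)) \<subseteq> A i" if "i \<in> I" for i
      using I that by (intro decseqD[OF dec]) simp
    then have "A (Max (insert 0 I)) \<subseteq> (\<Inter>i\<in>I. A i)" by blast
    with ne show "UNIV \<inter> (\<Inter>i\<in>I. A i) \<noteq> {}" by blast
  qed
  with inter show False by simp
qed

lemma countable_edges: "countable (UNIV :: 'd::finite edge set)"
proof -
  have "range (ends :: 'd edge \<Rightarrow> _) \<subseteq> (\<lambda>(v, w). {v, w}) ` UNIV"
  proof (rule image_subsetI)
    fix e :: "'d edge"
    obtain u v where "ends e = {u, v}" by (rule ends_cases)
    then show "ends e \<in> (\<lambda>(v, w). {v, w}) ` UNIV" by (intro image_eqI[of _ _ "(u, v)"]) simp_all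
  qed
  then have "countable (range (ends :: 'd edge \<Rightarrow> _))"
    by (rule countable_subset) simp
  then show ?thesis
    by (rule countable_image_inj_on) (simp add: inj_on_def ends_inject)
qed

text \<open>There are only countably many patterns, and they form a base of the product topology; so each
  open set is a countable union of cylinder events.\<close>

lemma sets_borel_subgraphs:
  "sets (borel :: 'd::finite lattice_subgraph measure) = sigma_sets UNIV {C. cylinder_event C}"
proof
  show "sigma_sets UNIV {C. cylinder_event C} \<subseteq> sets (borel :: 'd lattice_subgraph measure)"
    by (rule sets.sigma_sets_subset[of _ borel, simplified]) (auto intro: borel_open open_cylinder_event)
  have "U \<in> sigma_sets UNIV {C. cylinder_event C}" if U: "open U" for U :: "'d lattice_subgraph set"
  proof -
    define P where "P = {(A, S). finite A \<and> finite S \<and> pattern A S \<subseteq> U}"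
    have "countable (Collect finite :: 'd edge set set)"
      using countable_Collect_finite_subset[OF countable_edges] by simp
    then have "countable P"
      by (rule_tac countable_subset[of _ "Collect finite \<times> Collect finite"]) (auto simp: P_def)
    have "U = (\<Union>p\<in>P. pattern (fst p) (snd p))"
    proof
      show "U \<subseteq> (\<Union>p\<in>P. pattern (fst p) (snd p))"
      proof
        fix \<omega>
        assume \<omega>: "\<omega> \<in> U"
        obtain X where X: "\<omega> \<in> Pi\<^sub>E UNIV X" "finite {e. X e \<noteq> UNIV}" "Pi\<^sub>E UNIV X \<subseteq> U"
          using product_topology_open_contains_basis[of "\<lambda>_. euclidean" UNIV U \<omega>] U \<omega>
          by (auto simp: open_fun_def)
        define F where "F = {e. X e \<noteq> UNIV}"
        have "pattern {e \<in> F. \<not> \<omega> e} {e \<in> F. \<omega> e} \<subseteq> Pi\<^sub>E UNIV X"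
        proof
          fix \<omega>'
          assume "\<omega>' \<in> pattern {e \<in> F. \<not> \<omega> e} {e \<in> F. \<omega> e}"
          then have "\<omega>' e = \<omega> e" if "e \<in> F" for e using that by (auto simp: pattern_def)
          then have "\<omega>' e \<in> X e" for e
            using X(1) by (cases "e \<in> F") (auto simp: F_def PiE_iff)
          then show "\<omega>' \<in> Pi\<^sub>E UNIV X" by (simp add: PiE_iff)
        qed
        then have "({e \<in> F. \<not> \<omega> e}, {e \<in> F. \<omega> e}) \<in> P"
          using X by (auto simp: P_def F_def)
        moreover have "\<omega> \<in> pattern {e \<in> F. \<not> \<omega> e} {e \<in> F. \<omega> e}" by (simp add: pattern_def)
        ultimately show "\<omega> \<in> (\<Union>p\<in>P. pattern (fst p) (snd p))" by force
      qed
    qed (auto simp: P_def)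
    moreover have "(\<Union>p\<in>P. pattern (fst p) (snd p)) \<in> sigma_sets UNIV {C. cylinder_event C}"
      using \<open>countable P\<close> sigma_algebra_sigma_sets[of "{C. cylinder_event C}" UNIV]
      by (intro sigma_algebra.countable_UN'') (auto simp: P_def intro!: sigma_sets.Basic cylinder_event_pattern)
    ultimately show ?thesis by simp
  qed
  then show "sets (borel :: 'd lattice_subgraph measure) \<subseteq> sigma_sets UNIV {C. cylinder_event C}"
    unfolding borel_def by (subst sets_measure_of) (auto intro!: sigma_sets_mono)
qed

text \<open>Nonnegativity, additivity and total mass pass to the limit from the finite graphs. Continuity at
  the empty set is trivial because a decreasing sequence of cylinder events with empty intersection
  is eventually empty.\<close>

lemma lattice_measure_exists:
  "\<exists>\<mu> :: 'd::finite lattice_subgraph measure. prob_space \<mu> \<and> sets \<mu> = sets borel \<and>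
    (\<forall>C. cylinder_event C \<longrightarrow> measure \<mu> C = lattice_prob C)"
proof -
  let ?M = "{C :: 'd lattice_subgraph set. cylinder_event C}"
  let ?f = "\<lambda>C :: 'd lattice_subgraph set. ennreal (lattice_prob C)"
  interpret algebra UNIV ?M by (rule algebra_cylinder_events)
  have nonneg: "0 \<le> lattice_prob C" if "cylinder_event C" for C :: "'d lattice_subgraph set"
    by (rule tendsto_lowerbound[OF tendsto_lattice_prob[OF that] _ finite_subsets_at_top_neq_bot])
      (simp add: forest_prob_nonneg)
  have empty: "lattice_prob ({} :: 'd lattice_subgraph set) = 0"
    by (rule lattice_prob_eqI[OF cylinder_event_empty]) (simp add: forest_prob_empty)
  have UNIV: "lattice_prob (UNIV :: 'd lattice_subgraph set) = 1"
  proof (rule lattice_prob_eqI)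
    show "cylinder_event (UNIV :: 'd lattice_subgraph set)"
      using cylinder_event_Compl[OF cylinder_event_empty] by simp
    show "((\<lambda>G. forest_prob G (UNIV :: 'd lattice_subgraph set)) \<longlongrightarrow> 1) (finite_subsets_at_top UNIV)"
      by (rule tendsto_eventually) (auto simp: forest_prob_UNIV)
  qed
  have Un: "lattice_prob (C \<union> D) = lattice_prob C + lattice_prob D"
    if CD: "cylinder_event C" "cylinder_event D" "C \<inter> D = {}" for C D :: "'d lattice_subgraph set"
  proof (rule lattice_prob_eqI[OF cylinder_event_Un[OF CD(1,2)]])
    have "\<forall>\<^sub>F G in finite_subsets_at_top UNIV.
        forest_prob G C + forest_prob G D = forest_prob G (C \<union> D)"
      using CD by (auto simp: forest_prob_Un)
    with tendsto_add[OF tendsto_lattice_prob[OF CD(1)] tendsto_lattice_prob[OF CD(2)]]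
    show "((\<lambda>G. forest_prob G (C \<union> D)) \<longlongrightarrow> lattice_prob C + lattice_prob D) (finite_subsets_at_top UNIV)"
      by (rule Lim_transform_eventually)
  qed
  have "\<exists>\<mu>. (\<forall>C\<in>?M. \<mu> C = ?f C) \<and> measure_space UNIV (sigma_sets UNIV ?M) \<mu>"
  proof (rule caratheodory_empty_continuous)
    show "positive ?M ?f" by (simp add: positive_def empty)
    show "additive ?M ?f"
      by (auto simp: additive_def Un nonneg ennreal_plus[symmetric] simp del: ennreal_plus)
    show "?f C \<noteq> \<infinity>" for C by simp
    fix A :: "nat \<Rightarrow> 'd lattice_subgraph set"
    assume A: "range A \<subseteq> ?M" "decseq A" "(\<Inter>i. A i) = {}"
    then obtain n where "A n = {}" using decreasing_cylinder_events[of A] by blast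
    then have "A i = {}" if "n \<le> i" for i using decseqD[OF A(2) that] by blast
    then have "\<forall>\<^sub>F i in sequentially. ?f (A i) = 0"
      unfolding eventually_sequentially using empty by (intro exI[of _ n]) simp
    then show "(\<lambda>i. ?f (A i)) \<longlonglongrightarrow> 0" by (rule tendsto_eventually)
  qed
  then obtain m where m: "\<And>C. cylinder_event C \<Longrightarrow> m C = ?f C"
    and ms: "measure_space UNIV (sigma_sets UNIV ?M) m" by blast
  define \<mu> where "\<mu> = measure_of UNIV (sigma_sets UNIV ?M) m"
  have em: "emeasure \<mu> C = m C" if "C \<in> sigma_sets UNIV ?M" for C
    using ms that unfolding \<mu>_def measure_space_def by (intro emeasure_measure_of_sigma) auto
  have cyl: "emeasure \<mu> C = ?f C" if "cylinder_event C" for C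
    using that by (simp add: em m sigma_sets.Basic)
  have sets: "sets \<mu> = sets borel" and space: "space \<mu> = UNIV"
    by (simp_all add: \<mu>_def sets_borel_subgraphs sigma_sets_sigma_sets_eq space_measure_of_conv)
  have "prob_space \<mu>"
  proof (rule prob_spaceI)
    have "cylinder_event (UNIV :: 'd lattice_subgraph set)"
      using cylinder_event_Compl[OF cylinder_event_empty] by simp
    then show "emeasure \<mu> (space \<mu>) = 1" by (simp add: space cyl UNIV)
  qed
  moreover have "measure \<mu> C = lattice_prob C" if "cylinder_event C" for C
    using that by (simp add: measure_def cyl nonneg)
  ultimately show ?thesis using sets by blast
qed

lemma measure_uniform_spanning_tree:
  assumes "finite G" "connected_graph G" "cylinder_event C"
  shows "measure (uniform_spanning_tree G) C = forest_prob G C"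
proof -
  let ?U = "uniform_count_measure (spanning_trees G)"
  have fin: "finite (spanning_trees G)"
    using assms by (simp add: spanning_trees_eq_spanning_forests finite_spanning_forests)
  have "(\<lambda>T e. e \<in> T) \<in> measurable ?U borel"
    by (rule measurableI) (simp_all add: space_uniform_count_measure sets_uniform_count_measure)
  moreover have "C \<in> sets borel" using assms(3) by (simp add: open_cylinder_event borel_open)
  ultimately have "measure (uniform_spanning_tree G) C
      = measure ?U ((\<lambda>T e. e \<in> T) -` C \<inter> spanning_trees G)"
    by (simp add: uniform_spanning_tree_def measure_distr space_uniform_count_measure)
  also have "(\<lambda>T e. e \<in> T) -` C \<inter> spanning_trees G = {T \<in> spanning_trees G. (\<lambda>e. e \<in> T) \<in> C}"
    by blast
  finally show ?thesis
    using fin assms(2)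
    by (simp add: measure_uniform_count_measure forest_prob_def spanning_trees_eq_spanning_forests)
qed

section \<open>The limit is a spanning forest\<close>

lemma lattice_prob_null:
  assumes "cylinder_event C" "finite F"
    and "\<And>G. finite G \<Longrightarrow> F \<subseteq> G \<Longrightarrow> forest_prob G C = 0"
  shows "lattice_prob C = 0"
proof (rule lattice_prob_eqI[OF assms(1)], rule tendsto_eventually)
  show "\<forall>\<^sub>F G in finite_subsets_at_top UNIV. forest_prob G C = 0"
    unfolding eventually_finite_subsets_at_top using assms(2,3) by (intro exI[of _ F]) simp
qed

text \<open>Only the finitely many edges between vertices of the list matter.\<close>

lemma cylinder_event_cycle:
  fixes vs :: "(int ^ 'd::finite) list"
  shows "cylinder_event {\<omega>. cycle {e. \<omega> e} vs}"
proof -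
  let ?F = "{e :: 'd edge. ends e \<subseteq> set vs}"
  have "finite ?F"
  proof (rule finite_imageD)
    show "finite (ends ` ?F)" by (rule finite_subset[of _ "Pow (set vs)"]) auto
  qed (simp add: inj_on_def ends_inject)
  moreover have "cycle {e. \<omega> e} vs \<longleftrightarrow> cycle {e. \<omega>' e} vs" if "\<forall>e\<in>?F. \<omega> e = \<omega>' e" for \<omega> \<omega>'
  proof -
    have adj: "adjacent {e. \<omega> e} v w \<longleftrightarrow> adjacent {e. \<omega>' e} v w"
      if "v \<in> set vs" "w \<in> set vs" for v w
    proof -
      have "\<omega> e = \<omega>' e" if "ends e = {v, w}" for e
        using \<open>\<forall>e\<in>?F. \<omega> e = \<omega>' e\<close> that \<open>v \<in> set vs\<close> \<open>w \<in> set vs\<close> by simp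
      then show ?thesis unfolding adjacent_def by auto
    qed
    have "adjacent {e. \<omega> e} (last vs) (hd vs) \<longleftrightarrow> adjacent {e. \<omega>' e} (last vs) (hd vs)" if "3 \<le> length vs"
      using that by (intro adj last_in_set hd_in_set) auto
    moreover have "adjacent {e. \<omega> e} (vs ! i) (vs ! Suc i) \<longleftrightarrow> adjacent {e. \<omega>' e} (vs ! i) (vs ! Suc i)"
      if "Suc i < length vs" for i
      using that by (intro adj) auto
    ultimately show ?thesis unfolding cycle_def by blast
  qed
  ultimately show ?thesis
    unfolding cylinder_event_def by (intro exI[of _ ?F]) simp
qed

lemma lattice_prob_cycle: "lattice_prob {\<omega>. cycle {e. \<omega> e} vs} = 0"
proof (rule lattice_prob_null[OF cylinder_event_cycle finite.emptyI])
  show "forest_prob G {\<omega>. cycle {e. \<omega> e} vs} = 0" for G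
  proof -
    have "\<not> cycle T vs" if "T \<in> spanning_forests G" for T
      using that forest_iff_acyclic_edges[of T] by (auto simp: spanning_forests_def forest_def)
    then have "{T \<in> spanning_forests G. (\<lambda>e. e \<in> T) \<in> {\<omega>. cycle {e. \<omega> e} vs}} = {}" by auto
    then show ?thesis unfolding forest_prob_def by (simp only: card.empty of_nat_0 div_0)
  qed
qed

lemma finite_incident_edges:
  fixes v :: "int ^ 'd::finite"
  shows "finite {e. v \<in> ends e}"
proof -
  let ?N = "{w :: int ^ 'd. \<forall>i. w $ i \<in> {v $ i - 1..v $ i + 1}}"
  have "?N \<subseteq> vec_lambda ` (\<Pi>\<^sub>E i\<in>UNIV. {v $ i - 1..v $ i + 1})"
  proof
    fix w
    assume "w \<in> ?N"
    then have "vec_nth w \<in> (\<Pi>\<^sub>E i\<in>UNIV. {v $ i - 1..v $ i + 1})" by auto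
    then show "w \<in> vec_lambda ` (\<Pi>\<^sub>E i\<in>UNIV. {v $ i - 1..v $ i + 1})"
      by (rule rev_image_eqI) simp
  qed
  moreover have "finite (\<Pi>\<^sub>E i\<in>(UNIV :: 'd set). {v $ i - 1..v $ i + 1})"
    by (rule finite_PiE) simp_all
  ultimately have finN: "finite ?N" by (meson finite_imageI finite_subset)
  have near: "w \<in> ?N" if "nearest_neighbors v w" for w
  proof -
    have "\<bar>v $ i - w $ i\<bar> \<le> 1" for i
      using member_le_sum[of i UNIV "\<lambda>i. \<bar>v $ i - w $ i\<bar>"] that
      by (simp add: nearest_neighbors_def)
    then have "w $ i \<in> {v $ i - 1..v $ i + 1}" for i
      by (smt (verit) atLeastAtMost_iff)
    then show ?thesis by blast
  qed
  have "ends ` {e. v \<in> ends e} \<subseteq> (\<lambda>w. {v, w}) ` ?N"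
  proof (rule image_subsetI)
    fix e :: "'d edge"
    assume "e \<in> {e. v \<in> ends e}"
    then have v: "v \<in> ends e" by simp
    from ends[of e] obtain a b where ab: "ends e = {a, b}" "nearest_neighbors a b" by auto
    then have ba: "nearest_neighbors b a" by (simp add: nearest_neighbors_def abs_minus_commute)
    from v ab have "v = a \<or> v = b" by simp
    then obtain w where "ends e = {v, w}" "nearest_neighbors v w" using ab ba by (metis insert_commute)
    then show "ends e \<in> (\<lambda>w. {v, w}) ` ?N" using near by blast
  qed
  then have "finite (ends ` {e. v \<in> ends e})" by (rule finite_subset) (rule finite_imageI[OF finN])
  then show ?thesis by (rule finite_imageD) (simp add: inj_on_def ends_inject)
qed

lemma incident_edge_exists:
  fixes v :: "int ^ 'd::finite"
  obtains e where "v \<in> ends e"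
proof -
  let ?w = "v + axis undefined 1"
  have "nearest_neighbors v ?w"
    using nearest_neighbors_translate[of v 0 "axis undefined 1"] nearest_neighbors_axis[of undefined]
    by simp
  then have "ends (Edge {v, ?w}) = {v, ?w}" by (intro Edge_inverse) auto
  then show ?thesis by (intro that[of "Edge {v, ?w}"]) simp
qed

lemma cylinder_event_isolated: "cylinder_event {\<omega>. \<not> (\<exists>e. \<omega> e \<and> v \<in> ends e)}"
  unfolding cylinder_event_def by (rule exI[of _ "{e. v \<in> ends e}"]) (auto simp: finite_incident_edges)

text \<open>As soon as the finite graph contains one edge at \<open>v\<close>, the vertex \<open>v\<close> belongs to it, and its
  spanning forests cover \<open>v\<close>.\<close>

lemma lattice_prob_isolated: "lattice_prob {\<omega>. \<not> (\<exists>e. \<omega> e \<and> v \<in> ends e)} = 0"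
proof -
  obtain e where e: "v \<in> ends e" by (rule incident_edge_exists)
  show ?thesis
  proof (rule lattice_prob_null[OF cylinder_event_isolated, of "{e}"])
    fix G :: "'a edge set"
    assume G: "finite G" "{e} \<subseteq> G"
    have "\<exists>e\<in>T. v \<in> ends e" if "T \<in> spanning_forests G" for T
    proof -
      have "v \<in> vertices T"
        unfolding vertices_spanning_forest[OF that] using e G by (auto simp: vertices_def)
      then show ?thesis by (simp add: vertices_def)
    qed
    then have "{T \<in> spanning_forests G. (\<lambda>e. e \<in> T) \<in> {\<omega>. \<not> (\<exists>e. \<omega> e \<and> v \<in> ends e)}} = {}" by blast
    then show "forest_prob G {\<omega>. \<not> (\<exists>e. \<omega> e \<and> v \<in> ends e)} = 0"
      unfolding forest_prob_def by (simp only: card.empty of_nat_0 div_0)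
  qed simp
qed

lemma AE_spanning_forest:
  fixes \<mu> :: "'d::finite lattice_subgraph measure"
  assumes \<mu>: "prob_space \<mu>" "sets \<mu> = sets borel"
    and C: "\<And>C. cylinder_event C \<Longrightarrow> measure \<mu> C = lattice_prob C"
  shows "AE \<omega> in \<mu>. spanning_forest \<omega>"
proof -
  interpret prob_space \<mu> by fact
  have null: "AE \<omega> in \<mu>. \<omega> \<notin> C" if cyl: "cylinder_event C" "lattice_prob C = 0" for C
  proof (rule AE_not_in, rule null_setsI)
    show "emeasure \<mu> C = 0" using C[OF cyl(1)] cyl(2) by (simp add: emeasure_eq_measure)
    show "C \<in> sets \<mu>" using cyl(1) by (simp add: \<mu>(2) borel_open open_cylinder_event)
  qed
  have "AE \<omega> in \<mu>. \<forall>vs. \<not> cycle {e. \<omega> e} vs"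
    using null[OF cylinder_event_cycle lattice_prob_cycle] by (simp add: AE_all_countable)
  moreover have "AE \<omega> in \<mu>. \<forall>v. \<exists>e. \<omega> e \<and> v \<in> ends e"
    using null[OF cylinder_event_isolated lattice_prob_isolated] by (simp add: AE_all_countable)
  ultimately show ?thesis
    by eventually_elim (simp add: spanning_forest_def forest_def spans_lattice_def)
qed

section \<open>Translation invariance\<close>

lemma ends_translate_edge: "ends (translate_edge a e) = {u, v} \<longleftrightarrow> ends e = {u - a, v - a}"
proof -
  have "{u, v} = (+) a ` {u - a, v - a}" by simp
  moreover have "inj ((+) a)" by (simp add: inj_def)
  ultimately show ?thesis
    unfolding translate_edge.rep_eq by (metis inj_image_eq_iff)
qed

lemma translate_edge_inverse: "translate_edge (- a) (translate_edge a e) = e"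
  by (simp add: ends_inject[symmetric] translate_edge.rep_eq image_image)

lemma inj_translate_edge: "inj (translate_edge a)"
  by (metis injI translate_edge_inverse)

lemma translate_edge_image_inverse: "translate_edge (- a) ` translate_edge a ` F = F"
  by (simp add: image_image translate_edge_inverse)

lemma adjacent_translate: "adjacent (translate_edge a ` F) u v \<longleftrightarrow> adjacent F (u - a) (v - a)"
  by (simp add: adjacent_def ends_translate_edge)

lemma joined_translate: "joined (translate_edge a ` F) u v \<longleftrightarrow> joined F (u - a) (v - a)"
proof
  assume "joined (translate_edge a ` F) u v"
  then show "joined F (u - a) (v - a)"
    by (induction rule: rtranclp_induct)
      (auto simp: adjacent_translate intro: rtranclp.rtrancl_into_rtrancl)
next
  have "joined (translate_edge a ` F) (p + a) (q + a)" if "joined F p q" for p q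
    using that
    by (induction rule: rtranclp_induct)
      (auto simp: adjacent_translate intro: rtranclp.rtrancl_into_rtrancl)
  then show "joined F (u - a) (v - a) \<Longrightarrow> joined (translate_edge a ` F) u v" by fastforce
qed

lemma acyclic_edges_translate:
  assumes "acyclic_edges F"
  shows "acyclic_edges (translate_edge a ` F)"
  unfolding acyclic_edges_def
proof (intro ballI allI impI notI)
  fix g u v
  assume "g \<in> translate_edge a ` F" and g: "ends g = {u, v}"
    and j: "joined (translate_edge a ` F - {g}) u v"
  then obtain e where e: "e \<in> F" "g = translate_edge a e" by blast
  have "translate_edge a ` F - {g} = translate_edge a ` (F - {e})"
    using e by (simp add: image_set_diff[OF inj_translate_edge])
  then have "joined (F - {e}) (u - a) (v - a)" using j by (simp add: joined_translate)
  moreover have "ends e = {u - a, v - a}" using g e by (simp add: ends_translate_edge)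
  ultimately show False using assms e unfolding acyclic_edges_def by blast
qed

lemma spanning_forests_translate_subset:
  "(`) (translate_edge a) ` spanning_forests G \<subseteq> spanning_forests (translate_edge a ` G)"
proof (rule image_subsetI)
  fix T
  assume T: "T \<in> spanning_forests G"
  then have "joined (translate_edge a ` T) = joined (translate_edge a ` G)"
    by (intro ext) (simp add: joined_translate spanning_forests_def)
  with T show "translate_edge a ` T \<in> spanning_forests (translate_edge a ` G)"
    by (simp add: spanning_forests_def acyclic_edges_translate image_mono)
qed

lemma spanning_forests_translate:
  "spanning_forests (translate_edge a ` G) = (`) (translate_edge a) ` spanning_forests G"
proof
  show "spanning_forests (translate_edge a ` G) \<subseteq> (`) (translate_edge a) ` spanning_forests G"
  proof
    fix T
    assume "T \<in> spanning_forests (translate_edge a ` G)"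
    then have "translate_edge (- a) ` T \<in> spanning_forests (translate_edge (- a) ` translate_edge a ` G)"
      using spanning_forests_translate_subset by blast
    then have "translate_edge (- a) ` T \<in> spanning_forests G"
      by (simp only: translate_edge_image_inverse)
    moreover have "T = translate_edge a ` translate_edge (- a) ` T"
      using translate_edge_image_inverse[of "- a" T] by simp
    ultimately show "T \<in> (`) (translate_edge a) ` spanning_forests G" by (rule rev_image_eqI)
  qed
qed (rule spanning_forests_translate_subset)

lemma translate_subgraph_indicator:
  "translate_subgraph a (\<lambda>e. e \<in> T) = (\<lambda>e. e \<in> translate_edge a ` T)"
proof
  fix e
  have "translate_edge (- a) e \<in> T \<longleftrightarrow> translate_edge a (translate_edge (- a) e) \<in> translate_edge a ` T"
    by (simp add: inj_image_mem_iff[OF inj_translate_edge])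
  also have "translate_edge a (translate_edge (- a) e) = e"
    using translate_edge_inverse[of "- a" e] by simp
  finally show "translate_subgraph a (\<lambda>e. e \<in> T) e \<longleftrightarrow> e \<in> translate_edge a ` T"
    by (simp add: translate_subgraph_def)
qed

lemma forest_prob_translate:
  "forest_prob G (translate_subgraph a -` C) = forest_prob (translate_edge a ` G) C"
proof -
  have inj: "inj_on ((`) (translate_edge a)) A" for A
    by (simp add: inj_on_def inj_image_eq_iff[OF inj_translate_edge])
  have "{T \<in> spanning_forests (translate_edge a ` G). (\<lambda>e. e \<in> T) \<in> C}
      = (`) (translate_edge a) ` {T \<in> spanning_forests G. (\<lambda>e. e \<in> T) \<in> translate_subgraph a -` C}"
    by (auto simp: spanning_forests_translate translate_subgraph_indicator)
  then show ?thesis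
    by (simp add: forest_prob_def spanning_forests_translate card_image[OF inj])
qed

lemma cylinder_event_translate:
  assumes "cylinder_event C"
  shows "cylinder_event (translate_subgraph a -` C)"
proof -
  obtain F where F: "finite F" "\<And>\<omega> \<omega>'. \<forall>e\<in>F. \<omega> e = \<omega>' e \<Longrightarrow> \<omega> \<in> C \<longleftrightarrow> \<omega>' \<in> C"
    using assms by (rule cylinder_eventE) blast
  have "\<omega> \<in> translate_subgraph a -` C \<longleftrightarrow> \<omega>' \<in> translate_subgraph a -` C"
    if "\<forall>e\<in>translate_edge (- a) ` F. \<omega> e = \<omega>' e" for \<omega> \<omega>'
    using F(2)[of "translate_subgraph a \<omega>" "translate_subgraph a \<omega>'"] that
    by (simp add: translate_subgraph_def)
  then show ?thesis
    unfolding cylinder_event_def using F(1) by (intro exI[of _ "translate_edge (- a) ` F"]) simp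
qed

text \<open>Translation permutes the finite edge sets and preserves inclusion, so a limit along this net
  does not change when the net is translated.\<close>

lemma lattice_prob_translate:
  assumes "cylinder_event C"
  shows "lattice_prob (translate_subgraph a -` C) = lattice_prob C"
proof (rule lattice_prob_eqI[OF cylinder_event_translate[OF assms]])
  have "filterlim (\<lambda>G. translate_edge a ` G) (finite_subsets_at_top UNIV) (finite_subsets_at_top UNIV)"
    unfolding filterlim_finite_subsets_at_top eventually_finite_subsets_at_top
  proof (intro allI impI)
    fix X :: "'a edge set"
    assume X: "finite X \<and> X \<subseteq> UNIV"
    have "X \<subseteq> translate_edge a ` G" if "translate_edge (- a) ` X \<subseteq> G" for G
      using image_mono[OF that, of "translate_edge a"] translate_edge_image_inverse[of "- a" X] by simp
    with X show "\<exists>Y. finite Y \<and> Y \<subseteq> UNIV \<and> (\<forall>G. finite G \<and> Y \<subseteq> G \<and> G \<subseteq> UNIV \<longrightarrow>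
        finite (translate_edge a ` G) \<and> X \<subseteq> translate_edge a ` G \<and> translate_edge a ` G \<subseteq> UNIV)"
      by (intro exI[of _ "translate_edge (- a) ` X"]) simp
  qed
  from filterlim_compose[OF tendsto_lattice_prob[OF assms] this]
  show "((\<lambda>G. forest_prob G (translate_subgraph a -` C)) \<longlongrightarrow> lattice_prob C) (finite_subsets_at_top UNIV)"
    by (simp add: forest_prob_translate)
qed

text \<open>Both measures agree on the cylinder events, which generate the \<open>\<sigma>\<close>-algebra and are stable under
  intersection.\<close>

lemma translation_invariantI:
  fixes \<mu> :: "'d::finite lattice_subgraph measure"
  assumes \<mu>: "prob_space \<mu>" "sets \<mu> = sets borel"
    and C: "\<And>C. cylinder_event C \<Longrightarrow> measure \<mu> C = lattice_prob C"
  shows "translation_invariant \<mu>"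
  unfolding translation_invariant_def
proof
  fix a :: "int ^ 'd"
  interpret prob_space \<mu> by fact
  have space: "space \<mu> = UNIV" using sets_eq_imp_space_eq[OF \<mu>(2)] by simp
  have meas: "translate_subgraph a \<in> measurable \<mu> borel"
    using measurable_translate_subgraph measurable_cong_sets[OF \<mu>(2) refl] by blast
  interpret D: prob_space "distr \<mu> borel (translate_subgraph a)" by (rule prob_space_distr[OF meas])
  show "distr \<mu> borel (translate_subgraph a) = \<mu>"
  proof (rule measure_eqI_generator_eq[where \<Omega> = UNIV and E = "{C. cylinder_event C}" and A = "\<lambda>_. UNIV"])
    interpret algebra UNIV "{C :: 'd lattice_subgraph set. cylinder_event C}"
      by (rule algebra_cylinder_events)
    show "Int_stable {C :: 'd lattice_subgraph set. cylinder_event C}" by (rule Int_stable)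
    show "range (\<lambda>_. UNIV) \<subseteq> {C :: 'd lattice_subgraph set. cylinder_event C}" using top by blast
    fix C :: "'d lattice_subgraph set"
    assume "C \<in> {C. cylinder_event C}"
    then have cyl: "cylinder_event C" by simp
    have "measure (distr \<mu> borel (translate_subgraph a)) C = measure \<mu> (translate_subgraph a -` C)"
      using measure_distr[OF meas, of C] cyl by (simp add: space borel_open open_cylinder_event)
    also have "\<dots> = measure \<mu> C"
      using C[OF cyl] C[OF cylinder_event_translate[OF cyl]] lattice_prob_translate[OF cyl] by simp
    finally show "emeasure (distr \<mu> borel (translate_subgraph a)) C = emeasure \<mu> C"
      by (simp add: emeasure_eq_measure D.emeasure_eq_measure)
  qed (simp_all add: \<mu>(2) sets_borel_subgraphs D.emeasure_eq_measure)
qed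

section \<open>Convergence of the uniform spanning trees\<close>

theorem theorem2p3:
  fixes B :: "nat \<Rightarrow> 'd::finite edge set"
  assumes "CARD('d) \<ge> 2"
    and "\<And>n. finite (B n)"
    and "\<And>n. connected_graph (B n)"
    and "\<And>e. \<forall>\<^sub>F n in sequentially. e \<in> B n"
  shows "\<exists>\<mu> :: 'd lattice_subgraph measure.
           prob_space \<mu> \<and> sets \<mu> = sets borel \<and>
           (\<forall>C. cylinder_event C \<longrightarrow>
              (\<lambda>n. measure (uniform_spanning_tree (B n)) C) \<longlonglongrightarrow> measure \<mu> C) \<and>
           (AE \<omega> in \<mu>. spanning_forest \<omega>) \<and>
           translation_invariant \<mu>"
proof -
  obtain \<mu> :: "'d lattice_subgraph measure" where \<mu>: "prob_space \<mu>" "sets \<mu> = sets borel"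
    and C: "\<And>C. cylinder_event C \<Longrightarrow> measure \<mu> C = lattice_prob C"
    using lattice_measure_exists by blast
  have B: "filterlim B (finite_subsets_at_top UNIV) sequentially"
    unfolding filterlim_finite_subsets_at_top
  proof (intro allI impI)
    fix X :: "'d edge set"
    assume "finite X \<and> X \<subseteq> UNIV"
    then have "\<forall>\<^sub>F n in sequentially. \<forall>e\<in>X. e \<in> B n"
      using assms(4) by (intro eventually_ball_finite) auto
    then show "\<forall>\<^sub>F n in sequentially. finite (B n) \<and> X \<subseteq> B n \<and> B n \<subseteq> UNIV"
      by eventually_elim (use assms(2) in auto)
  qed
  have "(\<lambda>n. measure (uniform_spanning_tree (B n)) C) \<longlonglongrightarrow> measure \<mu> C" if "cylinder_event C" for C
    using filterlim_compose[OF tendsto_lattice_prob[OF that] B]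
    by (simp add: C[OF that] measure_uniform_spanning_tree[OF assms(2,3) that])
  with \<mu> AE_spanning_forest[OF \<mu> C] translation_invariantI[OF \<mu> C] show ?thesis by blast
qed

end
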